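(* For every integer $c\ge1$ and every integer $\ell\ge1$, \[ k^*(P_\ell,P_c)\le\delta(c)\cdot\ell \quad\text{and}\quad k^*(P_\ell,P_c)\ge(\delta(c)-o(1))\cdot\ell, \] where $\delta(c)$ is defined in the context and $o(1)$ stands for a non-negative function of $c$ and $\ell$ that tends to $0$ for $c$ fixed and $\ell\to\infty$.
   Context: Game: for a positive integer $k$, the $(P_\ell,P_c)$-avoidance game with tree size restriction $k$ is played by Builder and Painter on a vertex-colored graph (the board), initially empty. In each step Builder adds one new vertex with edges from some previously present vertices to it, so that the board always remains a forest all of whose components have at most $k$ vertices; Painter immediately and irrevocably colors it with color $1$ or $2$. Painter loses as soon as the board contains a path on $\ell$ vertices all colored $1$ or a path on $c$ vertices all colored $2$ ($P_m$ denotes the path on $m$ vertices). $k^*(P_\ell,P_c)$ is the smallest $k$ for which Builder can force Painter to lose within finitely many steps. Definition of $\delta(c)$: for integers $\ell,c\ge1$ let $W(\ell,c)$ be the set of sequences $\alpha=(\alpha_1,\dots,\alpha_d)$, $d=\ell+c-2$, with entries in $\{1,2\}$ having exactly $\ell-1$ ones and $c-1$ twos. Let $\nu_{i,s}:=1+|\{1\le j\le i:\alpha_j=s\}|$. Set $x_{1,0}:=x_{2,0}:=0$ and for $i=0,\dots,d$ in turn let $k_i:=1+\sum_{s\in\{1,2\}}\min_{j_1,j_2\ge0,\ j_1+j_2=\nu_{i,s}-1}(x_{s,j_1}+x_{s,j_2})$ and, if $i<d$, set $x_{s,\nu_{i,s}}:=k_i$ for $s=\alpha_{i+1}$; this defines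 $x_{1,0},\dots,x_{1,\ell-1}$ and $x_{2,0},\dots,x_{2,c-1}$. Put $\beta(\alpha):=1+\min_{j_1+j_2=c-1,\ j_1,j_2\ge0}(x_{2,j_1}+x_{2,j_2})$, $\delta(\alpha):=\min_{0\le j\le\ell-1}\frac{x_{1,j}+\beta(\alpha)}{j+1}$, $\delta(1):=1$, and for $c\ge2$, $\delta(c):=\sup\{\delta(\alpha):\ell\ge1,\ \alpha\in W(\ell,c),\ \alpha_{\ell+c-2}=2\}$. *)

theory Defs
  imports Complex_Main
begin

text \<open>
  Vertices are numbered in order of appearance, so that a board with \<open>n\<close> vertices has vertex
  set \<open>{..<n}\<close>.  Edges are two-element sets of vertices.  The value of \<open>colour\<close> is
  meaningful only on vertices of the board.
\<close>

record board =
  nverts :: nat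
  edges :: "nat set set"
  colour :: "nat \<Rightarrow> nat"

definition empty_board :: board where
  "empty_board = \<lparr>nverts = 0, edges = {}, colour = (\<lambda>_. 0)\<rparr>"

definition verts :: "board \<Rightarrow> nat set" where
  "verts B = {..<nverts B}"

definition add_vertex :: "board \<Rightarrow> nat set \<Rightarrow> nat \<Rightarrow> board" where
  "add_vertex B U s =
     \<lparr>nverts = Suc (nverts B),
      edges = edges B \<union> (\<lambda>u. {u, nverts B}) ` U,
      colour = (colour B)(nverts B := s)\<rparr>"

definition is_path :: "board \<Rightarrow> nat list \<Rightarrow> bool" where
  "is_path B p \<longleftrightarrow>
     p \<noteq> [] \<and> distinct p \<and> set p \<subseteq> verts B \<and> successively (\<lambda>u v. {u, v} \<in> edges B) p"

definition is_cycle :: "board \<Rightarrow> nat list \<Rightarrow> bool" where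
  "is_cycle B p \<longleftrightarrow> is_path B p \<and> length p \<ge> 3 \<and> {last p, hd p} \<in> edges B"

definition is_forest :: "board \<Rightarrow> bool" where
  "is_forest B \<longleftrightarrow> (\<nexists>p. is_cycle B p)"

definition component :: "board \<Rightarrow> nat \<Rightarrow> nat set" where
  "component B v = {u. (v, u) \<in> {(x, y). {x, y} \<in> edges B}\<^sup>*}"

definition admissible :: "nat \<Rightarrow> board \<Rightarrow> bool" where
  "admissible k B \<longleftrightarrow> is_forest B \<and> (\<forall>v\<in>verts B. card (component B v) \<le> k)"

definition has_mono_path :: "board \<Rightarrow> nat \<Rightarrow> nat \<Rightarrow> bool" where
  "has_mono_path B s m \<longleftrightarrow> (\<exists>p. is_path B p \<and> length p = m \<and> (\<forall>v\<in>set p. colour B v = s))"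

definition painter_lost :: "nat \<Rightarrow> nat \<Rightarrow> board \<Rightarrow> bool" where
  "painter_lost l c B \<longleftrightarrow> has_mono_path B 1 l \<or> has_mono_path B 2 c"

text \<open>
  Admissibility does not depend on colours: a choice of neighbours \<open>U\<close> is legal for one
  answer of Painter iff it is legal for the other.
\<close>

primrec forces_within :: "nat \<Rightarrow> nat \<Rightarrow> nat \<Rightarrow> nat \<Rightarrow> board \<Rightarrow> bool" where
  "forces_within k l c 0 B \<longleftrightarrow> painter_lost l c B"
| "forces_within k l c (Suc n) B \<longleftrightarrow>
     painter_lost l c B \<or>
     (\<exists>U \<subseteq> verts B. \<forall>s\<in>{1, 2}.
        admissible k (add_vertex B U s) \<and> forces_within k l c n (add_vertex B U s))"

definition builder_wins :: "nat \<Rightarrow> nat \<Rightarrow> nat \<Rightarrow> bool" where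
  "builder_wins k l c \<longleftrightarrow> (\<exists>n. forces_within k l c n empty_board)"

text \<open>Meaningful only if \<open>builder_wins k l c\<close> holds for some positive \<open>k\<close>.\<close>

definition k_star :: "nat \<Rightarrow> nat \<Rightarrow> nat" where
  "k_star l c = (LEAST k. k \<ge> 1 \<and> builder_wins k l c)"


text \<open>Sequences are lists; the entry \<open>\<alpha>\<^sub>i\<close> (\<open>1 \<le> i \<le> d\<close>) is \<open>\<alpha> ! (i - 1)\<close>.\<close>

definition W :: "nat \<Rightarrow> nat \<Rightarrow> nat list set" where
  "W l c = {\<alpha>. length \<alpha> = l + c - 2 \<and> set \<alpha> \<subseteq> {1, 2} \<and>
                count_list \<alpha> 1 = l - 1 \<and> count_list \<alpha> 2 = c - 1}"

definition \<nu> :: "nat list \<Rightarrow> nat \<Rightarrow> nat \<Rightarrow> nat" where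
  "\<nu> \<alpha> i s = 1 + card {j \<in> {1..i}. \<alpha> ! (j - 1) = s}"

definition min_split :: "(nat \<Rightarrow> nat) \<Rightarrow> nat \<Rightarrow> nat" where
  "min_split f m = Min {f j1 + f j2 | j1 j2. j1 + j2 = m}"

definition k_step :: "nat list \<Rightarrow> (nat \<Rightarrow> nat \<Rightarrow> nat) \<Rightarrow> nat \<Rightarrow> nat" where
  "k_step \<alpha> X i = 1 + (\<Sum>s\<in>{1, 2}. min_split (X s) (\<nu> \<alpha> i s - 1))"

text \<open>
  \<open>x_stage \<alpha> i s j\<close> is the value of \<open>x\<^bsub>s,j\<^esub>\<close> after the first \<open>i\<close> assignments have been made.
  Entries not yet assigned hold the dummy value \<open>0\<close>, which is never read: the indices read in
  step \<open>i\<close> are at most \<open>\<nu> \<alpha> i s - 1\<close>.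
\<close>

primrec x_stage :: "nat list \<Rightarrow> nat \<Rightarrow> nat \<Rightarrow> nat \<Rightarrow> nat" where
  "x_stage \<alpha> 0 = (\<lambda>s j. 0)"
| "x_stage \<alpha> (Suc i) =
     (x_stage \<alpha> i)(\<alpha> ! i :=
        (x_stage \<alpha> i (\<alpha> ! i))(\<nu> \<alpha> i (\<alpha> ! i) := k_step \<alpha> (x_stage \<alpha> i) i))"

definition x_val :: "nat list \<Rightarrow> nat \<Rightarrow> nat \<Rightarrow> nat" where
  "x_val \<alpha> = x_stage \<alpha> (length \<alpha>)"

definition \<beta> :: "nat \<Rightarrow> nat list \<Rightarrow> nat" where
  "\<beta> c \<alpha> = 1 + min_split (x_val \<alpha> 2) (c - 1)"

definition \<delta>_seq :: "nat \<Rightarrow> nat \<Rightarrow> nat list \<Rightarrow> real" where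
  "\<delta>_seq l c \<alpha> = (MIN j\<in>{0..l - 1}. real (x_val \<alpha> 1 j + \<beta> c \<alpha>) / real (j + 1))"

definition \<delta>_values :: "nat \<Rightarrow> real set" where
  "\<delta>_values c = {\<delta>_seq l c \<alpha> | l \<alpha>. l \<ge> 1 \<and> \<alpha> \<in> W l c \<and> last \<alpha> = 2}"

text \<open>The supremum is meaningful only if \<open>\<delta>_values c\<close> is bounded above.\<close>

definition \<delta> :: "nat \<Rightarrow> real" where
  "\<delta> c = (if c = 1 then 1 else Sup (\<delta>_values c))"

end

theory Submission
  imports Defs
begin

text \<open>
  The number \<open>k\<^sup>*(P\<^sub>\<ell>, P\<^sub>c)\<close> is the maximum of the last sizes \<open>k\<^sub>d\<close> over all \<open>\<alpha> \<in> W(\<ell>, c)\<close>.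
  Painter achieves it by fixing an optimal \<open>\<alpha>\<close> and keeping every path on \<open>j\<close> vertices in colour
  \<open>s\<close> inside a component with at least \<open>x\<^bsub>s,j\<^esub>\<close> vertices.  Builder keeps many copies of each
  monochromatic path obtained so far, joins the cheapest combination that would extend both longest
  paths by one vertex, and repeats this until Painter has settled on one colour often enough; the
  colours that Painter settles on spell out \<open>\<alpha>\<close>.

  With the twos of \<open>\<alpha>\<close> fixed, \<open>j + 1 \<mapsto> x\<^bsub>1,j\<^esub> + \<beta>\<close> is subadditive, and given by optimal splitting
  after the last two, so that linear lower bounds extend to all larger \<open>j\<close>.  For the upper
  bound, let \<open>m\<close> minimise \<open>(x\<^bsub>1,m-1\<^esub> + \<beta>) / m\<close> up to the last two and write \<open>\<ell> = q m + \<rho>\<close>.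
  Then \<open>k\<^sub>d \<le> q (x\<^bsub>1,m-1\<^esub> + \<beta>) + x\<^bsub>1,\<rho>\<^esub>\<close>, where the first term is at most \<open>\<delta>(c) q m\<close> and the second
  at most \<open>\<delta>(c) \<rho>\<close> by induction, being itself a last size for path length \<open>\<rho>\<close>.
\<close>

declare One_nat_def [simp del]

section \<open>The sequences of component sizes\<close>

lemma min_split_eq_image: "min_split f m = (MIN j\<in>{..m}. f j + f (m - j))"
proof -
  have "{f j1 + f j2 | j1 j2. j1 + j2 = m} = (\<lambda>j. f j + f (m - j)) ` {..m}"
  proof (intro equalityI subsetI)
    fix x assume "x \<in> {f j1 + f j2 | j1 j2. j1 + j2 = m}"
    then obtain j1 j2 where "j1 + j2 = m" "x = f j1 + f j2" by blast
    then show "x \<in> (\<lambda>j. f j + f (m - j)) ` {..m}" by (intro image_eqI[of _ _ j1]) auto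
  next
    fix x assume "x \<in> (\<lambda>j. f j + f (m - j)) ` {..m}"
    then obtain j where "j \<le> m" "x = f j + f (m - j)" by auto
    then show "x \<in> {f j1 + f j2 | j1 j2. j1 + j2 = m}"
      by (intro CollectI exI[of _ j] exI[of _ "m - j"]) auto
  qed
  then show ?thesis by (simp add: min_split_def)
qed

lemma min_split_le: "j1 + j2 = m \<Longrightarrow> min_split f m \<le> f j1 + f j2"
  unfolding min_split_eq_image by (rule Min_le) (auto simp: image_iff intro!: bexI[of _ j1])

lemma min_split_attained: obtains j1 j2 where "j1 + j2 = m" "min_split f m = f j1 + f j2"
proof -
  have "min_split f m \<in> (\<lambda>j. f j + f (m - j)) ` {..m}"
    unfolding min_split_eq_image by (rule Min_in) auto
  then obtain j where "j \<le> m" "min_split f m = f j + f (m - j)" by auto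
  then show ?thesis by (intro that[of j "m - j"]) auto
qed

lemma min_split_cong: "(\<And>j. j \<le> m \<Longrightarrow> f j = g j) \<Longrightarrow> min_split f m = min_split g m"
  unfolding min_split_eq_image by (rule arg_cong[where f = Min], rule image_cong) auto

lemma min_split_0: "min_split f 0 = f 0 + f 0"
  by (simp add: min_split_eq_image)

text \<open>Trim the two arms until their total length is exactly \<open>m\<close>; by monotonicity
  this is no dearer. So bounds on \<open>min_split\<close> survive when a length is capped.\<close>

lemma min_split_le_of_mono:
  assumes mono: "\<And>i j. i \<le> j \<Longrightarrow> j \<le> n \<Longrightarrow> f i \<le> f j"
    and "j1 \<le> n" "j2 \<le> n" "m \<le> j1 + j2"
  shows "min_split f m \<le> f j1 + f j2"
proof (cases "m \<le> j1")
  case True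
  have "min_split f m \<le> f m + f 0" by (rule min_split_le) simp
  also have "\<dots> \<le> f j1 + f j2" by (intro add_mono mono) (use assms True in auto)
  finally show ?thesis .
next
  case False
  have "min_split f m \<le> f j1 + f (m - j1)" by (rule min_split_le) (use False in simp)
  also have "\<dots> \<le> f j1 + f j2" by (intro add_mono mono) (use assms False in auto)
  finally show ?thesis .
qed

lemma min_split_mono:
  assumes mono: "\<And>i j. i \<le> j \<Longrightarrow> j \<le> n \<Longrightarrow> f i \<le> f j" and "m \<le> n" "i \<le> m"
  shows "min_split f i \<le> min_split f m"
proof -
  obtain j1 j2 where "j1 + j2 = m" "min_split f m = f j1 + f j2" by (rule min_split_attained)
  then show ?thesis
    using min_split_le_of_mono[of n f j1 j2 i] assms by auto
qed

section \<open>Dependence of the component sizes on prefixes\<close>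

lemma \<nu>_append: "i \<le> length \<alpha> \<Longrightarrow> \<nu> (\<alpha> @ \<gamma>) i s = \<nu> \<alpha> i s"
  unfolding \<nu>_def by (rule arg_cong[where f = "\<lambda>A. 1 + card A"]) (auto simp: nth_append)

lemma \<nu>_length: "\<nu> \<alpha> (length \<alpha>) s = 1 + count_list \<alpha> s"
proof -
  have "{j \<in> {1..length \<alpha>}. \<alpha> ! (j - 1) = s} = Suc ` {i. i < length \<alpha> \<and> s = \<alpha> ! i}"
  proof (intro equalityI subsetI)
    fix j assume "j \<in> {j \<in> {1..length \<alpha>}. \<alpha> ! (j - 1) = s}"
    then show "j \<in> Suc ` {i. i < length \<alpha> \<and> s = \<alpha> ! i}"
      by (intro image_eqI[of _ _ "j - 1"]) auto
  qed auto
  then show ?thesis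
    by (simp add: \<nu>_def card_image count_list_eq_length_filter length_filter_conv_card)
qed

lemma k_step_cong:
  assumes "\<And>s. \<nu> \<alpha> i s = \<nu> \<gamma> i s"
  shows "k_step \<alpha> X i = k_step \<gamma> X i"
  by (simp add: k_step_def assms)

lemma x_stage_append: "i \<le> length \<alpha> \<Longrightarrow> x_stage (\<alpha> @ \<gamma>) i = x_stage \<alpha> i"
proof (induction i)
  case (Suc i)
  then have "k_step (\<alpha> @ \<gamma>) (x_stage \<alpha> i) i = k_step \<alpha> (x_stage \<alpha> i) i"
    by (intro k_step_cong \<nu>_append) auto
  with Suc show ?case by (simp add: nth_append \<nu>_append)
qed simp

text \<open>The number \<open>k\<^sub>d\<close> belonging to the sequence \<open>\<alpha>\<close>; the other \<open>k\<^sub>i\<close> belong to its prefixes.\<close>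
definition k_last :: "nat list \<Rightarrow> nat" where
  "k_last \<alpha> = k_step \<alpha> (x_val \<alpha>) (length \<alpha>)"

text \<open>The quantity \<open>\<beta>\<close> with \<open>c - 1\<close> replaced by the number of
  twos in the sequence, so that it makes sense for prefixes as well.\<close>

definition two_cost :: "nat list \<Rightarrow> nat" where
  "two_cost \<alpha> = 1 + min_split (x_val \<alpha> 2) (count_list \<alpha> 2)"

lemma k_last_eq_sum:
  "k_last \<alpha> = 1 + min_split (x_val \<alpha> 1) (count_list \<alpha> 1) + min_split (x_val \<alpha> 2) (count_list \<alpha> 2)"
  by (simp add: k_last_def k_step_def \<nu>_length)

lemma k_last_eq: "k_last \<alpha> = two_cost \<alpha> + min_split (x_val \<alpha> 1) (count_list \<alpha> 1)"
  by (simp add: k_last_eq_sum two_cost_def)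

lemma x_val_Nil: "x_val [] s j = 0"
  by (simp add: x_val_def)

text \<open>Replaces the staged definition from here on. The step at index
  \<open>length \<alpha>\<close> reads only what \<open>\<alpha>\<close> has written, which makes
  induction on the last letter possible.\<close>

lemma x_val_snoc:
  "x_val (\<alpha> @ [t]) s j =
     (if s = t \<and> j = 1 + count_list \<alpha> t then k_last \<alpha> else x_val \<alpha> s j)"
proof -
  have "k_step (\<alpha> @ [t]) (x_stage \<alpha> (length \<alpha>)) (length \<alpha>) = k_last \<alpha>"
    unfolding k_last_def x_val_def by (intro k_step_cong \<nu>_append) auto
  then show ?thesis
    by (simp add: x_val_def x_stage_append nth_append \<nu>_append \<nu>_length)
qed

lemma x_val_0: "x_val \<alpha> s 0 = 0"
  by (induction \<alpha> rule: rev_induct) (auto simp: x_val_Nil x_val_snoc)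

lemma x_val_append: "j \<le> count_list \<alpha> s \<Longrightarrow> x_val (\<alpha> @ \<gamma>) s j = x_val \<alpha> s j"
proof (induction \<gamma> rule: rev_induct)
  case (snoc t \<gamma>)
  then show ?case unfolding append_assoc[symmetric] x_val_snoc by auto
qed simp

text \<open>Entry \<open>j\<close> was written by the \<open>j\<close>-th occurrence of
  \<open>s\<close>, and \<open>\<pi>\<close> is what precedes it. This turns claims about entries
  into claims about last sizes of shorter sequences, as inductions on the length need them.\<close>

lemma x_val_prefix:
  assumes "1 \<le> j" "j \<le> count_list \<alpha> s"
  obtains \<pi> \<gamma> where "\<alpha> = \<pi> @ s # \<gamma>" "count_list \<pi> s = j - 1" "x_val \<alpha> s j = k_last \<pi>"
proof -
  have "\<exists>\<pi> \<gamma>. \<alpha> = \<pi> @ s # \<gamma> \<and> count_list \<pi> s = j - 1 \<and> x_val \<alpha> s j = k_last \<pi>"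
    using assms
  proof (induction \<alpha> rule: rev_induct)
    case (snoc t \<alpha>)
    show ?case
    proof (cases "j \<le> count_list \<alpha> s")
      case True
      with snoc obtain \<pi> \<gamma> where "\<alpha> = \<pi> @ s # \<gamma>" "count_list \<pi> s = j - 1" "x_val \<alpha> s j = k_last \<pi>"
        by blast
      moreover have "x_val (\<alpha> @ [t]) s j = x_val \<alpha> s j" using True by (rule x_val_append)
      ultimately show ?thesis by (intro exI[of _ \<pi>] exI[of _ "\<gamma> @ [t]"]) auto
    next
      case False
      with snoc.prems have "t = s" "j = 1 + count_list \<alpha> s" by (auto split: if_splits)
      then show ?thesis by (intro exI[of _ \<alpha>] exI[of _ "[]"]) (simp add: x_val_snoc)
    qed
  qed simp
  then show ?thesis using that by blast
qed

text \<open>The claims need a joint induction: the entry written by \<open>t\<close> is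
  \<open>k_last \<alpha>\<close>, so monotonicity rests on the second claim, the second on the third
  for the shorter sequence, and the third on monotonicity.\<close>

lemma x_val_mono_and_le_k_last:
  "(\<forall>s i j. i \<le> j \<longrightarrow> j \<le> count_list \<alpha> s \<longrightarrow> x_val \<alpha> s i \<le> x_val \<alpha> s j) \<and>
   (\<forall>s. x_val \<alpha> s (count_list \<alpha> s) \<le> k_last \<alpha>) \<and> (\<forall>t. k_last \<alpha> \<le> k_last (\<alpha> @ [t]))"
proof (induction \<alpha> rule: rev_induct)
  case Nil
  have "min_split (x_val \<alpha> s) 0 = 0" for \<alpha> s by (simp add: min_split_0 x_val_0)
  then have "k_last [] = 1" "k_last [t] \<ge> 1" for t
    by (simp_all add: k_last_eq_sum)
  then show ?case by (simp add: x_val_Nil)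
next
  case (snoc t \<alpha>)
  let ?a = "\<alpha> @ [t]"
  have mono: "x_val ?a s i \<le> x_val ?a s j" if "i \<le> j" "j \<le> count_list ?a s" for s i j
  proof (cases "s = t \<and> j = 1 + count_list \<alpha> t")
    case True
    show ?thesis
    proof (cases "i = j")
      case False
      with True that have "i \<le> count_list \<alpha> s" by simp
      then have "x_val \<alpha> s i \<le> k_last \<alpha>" using snoc.IH by (meson le_trans order_refl)
      then show ?thesis using True False by (auto simp: x_val_snoc)
    qed simp
  next
    case False
    then have "j \<le> count_list \<alpha> s" using that by (auto split: if_splits)
    moreover from this have "x_val \<alpha> s i \<le> x_val \<alpha> s j" using snoc.IH that(1) by blast
    ultimately show ?thesis using that(1) by (simp only: x_val_append le_trans[OF that(1)])
  qed
  moreover have le: "x_val ?a s (count_list ?a s) \<le> k_last ?a" for s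
  proof -
    \<comment> \<open>An old last entry and a newly written one are both at most
      \<open>k_last \<alpha>\<close>.\<close>
    have "x_val ?a s (count_list ?a s) \<le> k_last \<alpha>"
      using snoc.IH by (simp add: x_val_snoc)
    then show ?thesis using snoc.IH le_trans by blast
  qed
  moreover have "k_last ?a \<le> k_last (?a @ [u])" for u
  proof -
    \<comment> \<open>\<open>k_last (?a @ [u])\<close> reads arrays that are one letter longer, so
      monotonicity is needed for those too.\<close>
    have mono': "x_val (?a @ [u]) s i \<le> x_val (?a @ [u]) s j"
      if "i \<le> j" "j \<le> count_list (?a @ [u]) s" for s i j
    proof (cases "j \<le> count_list ?a s")
      case True
      then show ?thesis using mono[of i j s] that by (simp only: x_val_append)
    next
      case False
      with that have u: "u = s" "j = 1 + count_list ?a s" by (auto split: if_splits)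
      show ?thesis
      proof (cases "i = j")
        case False
        then have "i \<le> count_list ?a s" using u that by simp
        then have "x_val (?a @ [u]) s i \<le> k_last ?a"
          using mono[of i "count_list ?a s" s] le[of s] unfolding x_val_append[OF \<open>i \<le> count_list ?a s\<close>]
          by linarith
        then show ?thesis using u by (subst (2) x_val_snoc) simp
      qed simp
    qed
    have "min_split (x_val ?a s) (count_list ?a s)
        \<le> min_split (x_val (?a @ [u]) s) (count_list (?a @ [u]) s)" for s
    proof -
      have "min_split (x_val ?a s) (count_list ?a s)
          = min_split (x_val (?a @ [u]) s) (count_list ?a s)"
        by (rule min_split_cong) (simp only: x_val_append)
      also have "\<dots> \<le> min_split (x_val (?a @ [u]) s) (count_list (?a @ [u]) s)"
        using mono' by (intro min_split_mono[of "count_list (?a @ [u]) s"]) simp_all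
      finally show ?thesis .
    qed
    then show ?thesis unfolding k_last_eq_sum by (intro add_mono) auto
  qed
  ultimately show ?case by blast
qed

lemma x_val_mono: "i \<le> j \<Longrightarrow> j \<le> count_list \<alpha> s \<Longrightarrow> x_val \<alpha> s i \<le> x_val \<alpha> s j"
  using x_val_mono_and_le_k_last by blast

lemma k_last_append: "k_last \<alpha> \<le> k_last (\<alpha> @ \<gamma>)"
proof (induction \<gamma> rule: rev_induct)
  case (snoc t \<gamma>)
  then show ?case
    using x_val_mono_and_le_k_last[of "\<alpha> @ \<gamma>"] unfolding append_assoc by (blast intro: le_trans)
qed simp

lemma min_split_x_val_mono:
  assumes "i \<le> m" "m \<le> count_list \<alpha> s"
  shows "min_split (x_val \<alpha> s) i \<le> min_split (x_val \<alpha> s) m"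
  using assms x_val_mono by (intro min_split_mono[of "count_list \<alpha> s"])

lemma min_split_x_val_append:
  "m \<le> count_list \<alpha> s \<Longrightarrow> min_split (x_val (\<alpha> @ \<gamma>) s) m = min_split (x_val \<alpha> s) m"
  by (rule min_split_cong) (simp add: x_val_append)

lemma two_cost_append: "two_cost \<alpha> \<le> two_cost (\<alpha> @ \<gamma>)"
proof -
  have "min_split (x_val \<alpha> 2) (count_list \<alpha> 2) = min_split (x_val (\<alpha> @ \<gamma>) 2) (count_list \<alpha> 2)"
    by (simp add: min_split_x_val_append)
  also have "\<dots> \<le> min_split (x_val (\<alpha> @ \<gamma>) 2) (count_list (\<alpha> @ \<gamma>) 2)"
    by (rule min_split_x_val_mono) auto
  finally show ?thesis by (simp add: two_cost_def)
qed

lemma count_list_replicate: "count_list (replicate n x) y = (if x = y then n else 0)"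
  by (induction n) auto

text \<open>Ones write only into the array of colour 1, so the cost of the twos is fixed from the
  last two on.\<close>

lemma two_cost_append_ones: "two_cost (\<alpha> @ replicate t 1) = two_cost \<alpha>"
  by (simp add: two_cost_def min_split_x_val_append count_list_replicate)

lemma two_cost_le: "two_cost \<alpha> \<le> 1 + x_val \<alpha> 2 (count_list \<alpha> 2)"
  using min_split_le[of 0 "count_list \<alpha> 2" "count_list \<alpha> 2" "x_val \<alpha> 2"]
  by (simp add: two_cost_def x_val_0)

text \<open>Painter, facing a vertex that would complete a path on \<open>a\<close> vertices in colour 1 and one on
  \<open>b\<close> vertices in colour 2, can afford the colour whose entry comes first in \<open>\<alpha>\<close>.\<close>

lemma affordable_colour:
  fixes \<alpha> :: "nat list"
  assumes "a \<le> count_list \<alpha> 1" "b \<le> count_list \<alpha> 2"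
  shows "let S = 1 + min_split (x_val \<alpha> 1) a + min_split (x_val \<alpha> 2) b in
     (a < count_list \<alpha> 1 \<and> x_val \<alpha> 1 (Suc a) \<le> S) \<or>
     (b < count_list \<alpha> 2 \<and> x_val \<alpha> 2 (Suc b) \<le> S) \<or>
     (a = count_list \<alpha> 1 \<and> b = count_list \<alpha> 2)"
  using assms
proof (induction \<alpha> arbitrary: a b rule: rev_induct)
  case (snoc t \<alpha>)
  let ?a = "\<alpha> @ [t]"
  \<comment> \<open>Truncation brings the lengths into the range of the shorter sequence and can
    only lower the total \<open>S\<close>.\<close>
  define a0 where "a0 = min a (count_list \<alpha> 1)"
  define b0 where "b0 = min b (count_list \<alpha> 2)"
  define S0 where "S0 = 1 + min_split (x_val \<alpha> 1) a0 + min_split (x_val \<alpha> 2) b0"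
  define S where "S = 1 + min_split (x_val ?a 1) a + min_split (x_val ?a 2) b"
  have "S0 = 1 + min_split (x_val ?a 1) a0 + min_split (x_val ?a 2) b0"
    unfolding S0_def a0_def b0_def by (simp add: min_split_x_val_append)
  also have "\<dots> \<le> S" unfolding S_def
    using snoc.prems by (intro add_mono min_split_x_val_mono) (auto simp: a0_def b0_def)
  finally have S0: "S0 \<le> S" .
  have ext: "x_val ?a s (Suc i) = x_val \<alpha> s (Suc i)" if "i < count_list \<alpha> s" for s i
    using that by (intro x_val_append) simp
  consider "a0 < count_list \<alpha> 1" "x_val \<alpha> 1 (Suc a0) \<le> S0"
    | "b0 < count_list \<alpha> 2" "x_val \<alpha> 2 (Suc b0) \<le> S0"
    | "a0 = count_list \<alpha> 1" "b0 = count_list \<alpha> 2"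
    using snoc.IH[of a0 b0] by (auto simp: a0_def b0_def S0_def Let_def)
  then have "(a < count_list ?a 1 \<and> x_val ?a 1 (Suc a) \<le> S) \<or>
     (b < count_list ?a 2 \<and> x_val ?a 2 (Suc b) \<le> S) \<or>
     (a = count_list ?a 1 \<and> b = count_list ?a 2)"
  proof cases
    case 1
    then have "a0 = a" by (auto simp: a0_def)
    then show ?thesis using 1 S0 ext[of a 1] by auto
  next
    case 2
    then have "b0 = b" by (auto simp: b0_def)
    then show ?thesis using 2 S0 ext[of b 2] by auto
  next
    case 3
    \<comment> \<open>This is exactly the entry that a letter \<open>t\<close> in {1, 2} writes.
      That colour is affordable at this price, unless its length already counts the new entry; then
      both lengths are maximal.\<close>
    then have "S0 = k_last \<alpha>" by (simp add: S0_def k_last_eq_sum)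
    then show ?thesis
      using 3 S0 snoc.prems
      by (cases "t = 1"; cases "t = 2") (auto simp: a0_def b0_def x_val_snoc min_def split: if_splits)
  qed
  then show ?case by (simp add: S_def Let_def)
qed simp

section \<open>Linear bounds\<close>

text \<open>Subadditivity of \<open>j + 1 \<mapsto> x_val \<alpha> 1 j + two_cost \<alpha>\<close>.
  The entry was an optimal split plus the cost of the twos at the time, and later twos only raise
  that cost.\<close>

lemma x_val_split_le:
  assumes "1 \<le> j" "j \<le> count_list \<alpha> 1" "i1 + i2 = j - 1"
  shows "x_val \<alpha> 1 j \<le> two_cost \<alpha> + x_val \<alpha> 1 i1 + x_val \<alpha> 1 i2"
proof -
  obtain \<pi> \<gamma> where p: "\<alpha> = \<pi> @ 1 # \<gamma>" "count_list \<pi> 1 = j - 1" "x_val \<alpha> 1 j = k_last \<pi>"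
    using assms(1,2) by (rule x_val_prefix)
  have "k_last \<pi> = two_cost \<pi> + min_split (x_val \<alpha> 1) (j - 1)"
    using p by (simp add: k_last_eq min_split_x_val_append)
  also have "\<dots> \<le> two_cost \<alpha> + (x_val \<alpha> 1 i1 + x_val \<alpha> 1 i2)"
    using p assms(3) by (intro add_mono min_split_le) (auto simp: two_cost_append)
  finally show ?thesis using p by simp
qed

text \<open>Apply the preceding bound \<open>q\<close> times with one arm of length
  \<open>m - 1\<close>; together with the joining vertex each round shortens the path by
  \<open>m\<close>.\<close>

lemma x_val_periodic_le:
  assumes "1 \<le> m" "q * m + \<rho> \<le> count_list \<alpha> 1"
  shows "x_val \<alpha> 1 (q * m + \<rho>) \<le> q * (x_val \<alpha> 1 (m - 1) + two_cost \<alpha>) + x_val \<alpha> 1 \<rho>"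
  using assms(2)
proof (induction q)
  case (Suc q)
  have "x_val \<alpha> 1 (Suc q * m + \<rho>) \<le> two_cost \<alpha> + x_val \<alpha> 1 (m - 1) + x_val \<alpha> 1 (q * m + \<rho>)"
    using Suc.prems assms(1) by (intro x_val_split_le) auto
  also have "\<dots> \<le> Suc q * (x_val \<alpha> 1 (m - 1) + two_cost \<alpha>) + x_val \<alpha> 1 \<rho>"
    using Suc by simp
  finally show ?case .
qed simp

lemma k_last_periodic_le:
  assumes "1 \<le> m" "m \<le> 1 + count_list \<alpha> 1" "\<rho> \<le> count_list \<alpha> 1" "q * m + \<rho> = 1 + count_list \<alpha> 1"
  shows "k_last \<alpha> \<le> q * (x_val \<alpha> 1 (m - 1) + two_cost \<alpha>) + x_val \<alpha> 1 \<rho>"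
proof -
  \<comment> \<open>The last size is the entry that one further 1 would write, and this letter
    leaves the cost of the twos unchanged.\<close>
  have "k_last \<alpha> = x_val (\<alpha> @ [1]) 1 (q * m + \<rho>)"
    using assms by (simp add: x_val_snoc)
  also have "\<dots> \<le> q * (x_val (\<alpha> @ [1]) 1 (m - 1) + two_cost (\<alpha> @ [1])) + x_val (\<alpha> @ [1]) 1 \<rho>"
    using assms by (intro x_val_periodic_le) auto
  also have "\<dots> = q * (x_val \<alpha> 1 (m - 1) + two_cost \<alpha>) + x_val \<alpha> 1 \<rho>"
    using assms two_cost_append_ones[of \<alpha> 1] by (simp add: x_val_append One_nat_def)
  finally show ?thesis .
qed

lemma last_two_decomp:
  fixes \<alpha> :: "nat list"
  assumes "set \<alpha> \<subseteq> {1, 2}" "2 \<in> set \<alpha>"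
  obtains \<alpha>1 t where "\<alpha> = \<alpha>1 @ [2] @ replicate t 1"
proof -
  obtain \<alpha>1 \<gamma> where d: "\<alpha> = \<alpha>1 @ 2 # \<gamma>" "2 \<notin> set \<gamma>"
    using split_list_last[OF assms(2)] by blast
  then have "\<forall>x\<in>set \<gamma>. x = 1" using assms(1) by auto
  then have "\<gamma> = replicate (length \<gamma>) 1" by (metis replicate_length_same)
  then show ?thesis using that d by auto
qed

lemma k_last_le_of_no_two:
  fixes \<alpha> :: "nat list"
  assumes "count_list \<alpha> 2 = 0"
  shows "k_last \<alpha> \<le> 1 + count_list \<alpha> 1"
proof -
  \<comment> \<open>Period 1: the entry at 0 vanishes and, without twos,
    \<open>two_cost \<alpha>\<close> is at most 1.\<close>
  have "k_last \<alpha> \<le> (1 + count_list \<alpha> 1) * (x_val \<alpha> 1 (1 - 1) + two_cost \<alpha>) + x_val \<alpha> 1 0"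
    by (rule k_last_periodic_le) auto
  also have "\<dots> \<le> (1 + count_list \<alpha> 1) * 1 + 0"
    using assms two_cost_le[of \<alpha>] by (intro add_mono mult_left_mono) (simp_all add: x_val_0)
  finally show ?thesis by simp
qed

lemma pow_step_le: "C \<le> 2 ^ n - (1::nat) \<Longrightarrow> 2 * C + 1 \<le> 2 ^ Suc n - 1"
proof -
  assume "C \<le> 2 ^ n - (1::nat)"
  moreover have "1 \<le> (2::nat) ^ n" by simp
  ultimately show ?thesis unfolding power_Suc by linarith
qed

text \<open>Each two at most doubles the coefficient and adds one. Let \<open>P\<close> be one more
  than the number of ones before the last two. The cost of the twos and the entry at
  \<open>P - 1\<close> are both bounded by induction with one two fewer, so a block of length
  \<open>P\<close> costs at most \<open>(2 * C + 1) * P\<close>; then the periodic bound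
  applies.\<close>

lemma k_last_linear_bound:
  "set \<alpha> \<subseteq> {1, 2} \<Longrightarrow> k_last \<alpha> \<le> (2 ^ (1 + count_list \<alpha> 2) - 1) * (1 + count_list \<alpha> 1)"
proof (induction "length \<alpha>" arbitrary: \<alpha> rule: less_induct)
  case less
  let ?C = "\<lambda>n. 2 ^ (1 + n) - 1 :: nat"
  have C_mono: "?C i \<le> ?C j" if "i \<le> j" for i j
    using that by (intro diff_le_mono power_increasing) auto
  have X: "x_val \<alpha> 1 j \<le> ?C (count_list \<alpha> 2) * j" if j: "j \<le> count_list \<alpha> 1" for j
  proof (cases "j = 0")
    case False
    then have "1 \<le> j" by simp
    then obtain \<pi> \<gamma> where p: "\<alpha> = \<pi> @ 1 # \<gamma>" "count_list \<pi> 1 = j - 1" "x_val \<alpha> 1 j = k_last \<pi>"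
      using j by (rule x_val_prefix)
    have "k_last \<pi> \<le> ?C (count_list \<pi> 2) * (1 + count_list \<pi> 1)"
      using less.prems p(1) by (intro less.hyps) auto
    also have "\<dots> \<le> ?C (count_list \<alpha> 2) * j"
      using p False by (intro mult_mono C_mono) auto
    finally show ?thesis using p by simp
  qed (simp add: x_val_0)
  show ?case
  proof (cases "2 \<in> set \<alpha>")
    case False
    then have "count_list \<alpha> 2 = 0" by (simp add: count_list_0_iff)
    then show ?thesis using k_last_le_of_no_two[of \<alpha>] by simp
  next
    case True
    then obtain \<alpha>1 t where a: "\<alpha> = \<alpha>1 @ [2] @ replicate t 1"
      using last_two_decomp less.prems by blast
    define a0 where "a0 = \<alpha>1 @ [2]"
    have aa: "\<alpha> = a0 @ replicate t 1" by (simp add: a a0_def)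
    have c2: "count_list \<alpha> 2 = Suc (count_list \<alpha>1 2)"
      by (simp add: a count_list_replicate)
    define P where "P = 1 + count_list \<alpha>1 1"
    define C where "C = ?C (count_list \<alpha>1 2)"
    have P: "P \<le> 1 + count_list \<alpha> 1" "1 \<le> P" by (simp_all add: P_def a)
    have "two_cost \<alpha> = two_cost a0" unfolding aa by (rule two_cost_append_ones)
    \<comment> \<open>The last entry of colour 2 was written by the final two, which directly
      follows \<open>\<alpha>1\<close>.\<close>
    also have "\<dots> \<le> 1 + k_last \<alpha>1"
      using two_cost_le[of a0] by (simp add: a0_def x_val_snoc)
    also have "k_last \<alpha>1 \<le> C * P"
      unfolding C_def P_def using less a by simp
    finally have b: "two_cost \<alpha> \<le> 1 + C * P" by simp
    have x: "x_val \<alpha> 1 (P - 1) \<le> C * (P - 1)"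
    proof (cases "P = 1")
      case False
      then have P1: "1 \<le> P - 1" "P - 1 \<le> count_list \<alpha>1 1" using P by (auto simp: P_def)
      then obtain \<pi> \<gamma> where p: "\<alpha>1 = \<pi> @ 1 # \<gamma>" "count_list \<pi> 1 = P - 1 - 1"
          "x_val \<alpha>1 1 (P - 1) = k_last \<pi>"
        by (rule x_val_prefix)
      have "x_val \<alpha> 1 (P - 1) = x_val \<alpha>1 1 (P - 1)"
        unfolding a using P1(2) by (rule x_val_append)
      also have "\<dots> = k_last \<pi>" by (rule p(3))
      also have "k_last \<pi> \<le> ?C (count_list \<pi> 2) * (1 + count_list \<pi> 1)"
        using less.prems a p by (intro less.hyps) auto
      also have "\<dots> \<le> C * (P - 1)"
        unfolding C_def using p P1 by (intro mult_mono C_mono) auto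
      finally show ?thesis .
    qed (simp add: x_val_0)
    define q where "q = (1 + count_list \<alpha> 1) div P"
    define r where "r = (1 + count_list \<alpha> 1) mod P"
    have qr: "q * P + r = 1 + count_list \<alpha> 1" by (simp add: q_def r_def)
    have "r < P" using P by (simp add: r_def)
    then have r: "r \<le> count_list \<alpha> 1" using P by simp
    have "1 + C * P + C * (P - 1) \<le> (2 * C + 1) * P"
      using P(2) by (cases P) (auto simp: algebra_simps)
    also have "\<dots> \<le> ?C (count_list \<alpha> 2) * P"
      using pow_step_le[of C "1 + count_list \<alpha>1 2"] unfolding C_def c2
      by (intro mult_right_mono) auto
    finally have step: "x_val \<alpha> 1 (P - 1) + two_cost \<alpha> \<le> ?C (count_list \<alpha> 2) * P"
      using b x by simp
    have "k_last \<alpha> \<le> q * (x_val \<alpha> 1 (P - 1) + two_cost \<alpha>) + x_val \<alpha> 1 r"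
      using P r qr by (intro k_last_periodic_le)
    also have "\<dots> \<le> q * (?C (count_list \<alpha> 2) * P) + ?C (count_list \<alpha> 2) * r"
      using step X r by (intro add_mono mult_left_mono) auto
    also have "\<dots> = ?C (count_list \<alpha> 2) * (q * P + r)" by (simp only: add_mult_distrib2 mult.left_commute mult.assoc)
    finally show ?thesis unfolding qr .
  qed
qed

section \<open>The numbers \<open>\<delta>\<close> and the linear upper bound\<close>

lemma \<beta>_eq_two_cost: "\<alpha> \<in> W l c \<Longrightarrow> \<beta> c \<alpha> = two_cost \<alpha>"
  by (simp add: W_def \<beta>_def two_cost_def)

lemma \<delta>_seq_le: "j < l \<Longrightarrow> \<delta>_seq l c \<alpha> \<le> real (x_val \<alpha> 1 j + \<beta> c \<alpha>) / real (j + 1)"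
  unfolding \<delta>_seq_def by (intro Min_le) auto

lemma \<delta>_seq_attained:
  assumes "1 \<le> l"
  obtains j where "j < l" "\<delta>_seq l c \<alpha> = real (x_val \<alpha> 1 j + \<beta> c \<alpha>) / real (j + 1)"
proof -
  have "\<delta>_seq l c \<alpha> \<in> (\<lambda>j. real (x_val \<alpha> 1 j + \<beta> c \<alpha>) / real (j + 1)) ` {0..l - 1}"
    unfolding \<delta>_seq_def by (intro Min_in) auto
  then obtain j where "j \<in> {0..l - 1}" "\<delta>_seq l c \<alpha> = real (x_val \<alpha> 1 j + \<beta> c \<alpha>) / real (j + 1)"
    by auto
  then show ?thesis using assms by (intro that[of j]) auto
qed

lemma W_iff:
  assumes "1 \<le> l" "1 \<le> c"
  shows "\<alpha> \<in> W l c \<longleftrightarrow> set \<alpha> \<subseteq> {1, 2} \<and> count_list \<alpha> 1 = l - 1 \<and> count_list \<alpha> 2 = c - 1"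
proof -
  have "length \<alpha> = count_list \<alpha> 1 + count_list \<alpha> 2" if "set \<alpha> \<subseteq> {1, 2}" for \<alpha> :: "nat list"
    using that by (induction \<alpha>) auto
  then show ?thesis using assms by (auto simp: W_def)
qed

lemma finite_W: "finite (W l c)"
  by (rule finite_subset[OF _ finite_lists_length_eq[of "{1, 2}" "l + c - 2"]]) (auto simp: W_def)

text \<open>Together with \<open>k_last_append\<close> this bounds the last size of every sequence
  within the quotas by that of a member of \<open>W l c\<close>.\<close>

lemma extend_to_W:
  fixes \<alpha> :: "nat list"
  assumes "set \<alpha> \<subseteq> {1, 2}" "count_list \<alpha> 1 < l" "count_list \<alpha> 2 < c"
  shows "\<alpha> @ replicate (l - 1 - count_list \<alpha> 1) 1 @ replicate (c - 1 - count_list \<alpha> 2) 2 \<in> W l c"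
  using assms by (subst W_iff) (auto simp: count_list_replicate)

text \<open>Makes the supremum in \<open>\<delta>\<close> genuine. Already the term for
  \<open>j = l - 1\<close> is bounded: both summands in its numerator are at most the last size,
  which is linear in \<open>l\<close> for fixed \<open>c\<close>.\<close>

lemma bdd_above_\<delta>_values:
  assumes "2 \<le> c"
  shows "bdd_above (\<delta>_values c)"
proof -
  have "d \<le> 2 ^ Suc c" if "d \<in> \<delta>_values c" for d
  proof -
    from that obtain l \<alpha> where l: "1 \<le> l" "\<alpha> \<in> W l c" and d: "d = \<delta>_seq l c \<alpha>"
      unfolding \<delta>_values_def by blast
    then have a: "set \<alpha> \<subseteq> {1, 2}" "count_list \<alpha> 1 = l - 1" "count_list \<alpha> 2 = c - 1"
      using assms by (auto simp: W_def)
    have "x_val \<alpha> 1 (l - 1) \<le> k_last \<alpha>"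
      using x_val_mono_and_le_k_last[of \<alpha>] a by metis
    moreover have "\<beta> c \<alpha> \<le> k_last \<alpha>"
      using \<beta>_eq_two_cost[OF l(2)] by (simp add: k_last_eq)
    moreover have "k_last \<alpha> \<le> (2 ^ c - 1) * l"
      using k_last_linear_bound[of \<alpha>] a l assms by simp
    moreover have "(2 ^ c - 1) * l \<le> 2 ^ c * l" by (intro mult_right_mono) auto
    ultimately have "x_val \<alpha> 1 (l - 1) + \<beta> c \<alpha> \<le> 2 * (2 ^ c * l)" by linarith
    then have "x_val \<alpha> 1 (l - 1) + \<beta> c \<alpha> \<le> 2 ^ Suc c * l" by simp
    then have "real (x_val \<alpha> 1 (l - 1) + \<beta> c \<alpha>) \<le> 2 ^ Suc c * real l"
      using of_nat_mono by fastforce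
    moreover have "d \<le> real (x_val \<alpha> 1 (l - 1) + \<beta> c \<alpha>) / real l"
      using \<delta>_seq_le[of "l - 1" l c \<alpha>] l by (simp add: d)
    ultimately have "d \<le> 2 ^ Suc c * real l / real l"
      using l by (meson divide_right_mono of_nat_0_le_iff order_trans)
    then show ?thesis using l by simp
  qed
  then show ?thesis by (auto simp: bdd_above_def)
qed

lemma \<delta>_seq_le_\<delta>:
  assumes "2 \<le> c" "1 \<le> l" "\<alpha> \<in> W l c" "last \<alpha> = 2"
  shows "\<delta>_seq l c \<alpha> \<le> \<delta> c"
proof -
  have "\<delta>_seq l c \<alpha> \<in> \<delta>_values c" using assms unfolding \<delta>_values_def by blast
  then show ?thesis
    using cSup_upper[OF _ bdd_above_\<delta>_values] assms by (simp add: \<delta>_def)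
qed

text \<open>The minimiser \<open>j\<close> is taken in the prefix \<open>a0\<close> ending with the
  last two, since \<open>\<delta>_values\<close> admits only such sequences; the trailing ones
  change neither its entries up to \<open>j\<close> nor the cost of the twos. The period is
  \<open>j + 1\<close>, and the remainder \<open>r < l\<close> is left to the induction.\<close>

lemma k_last_le_\<delta>:
  assumes "1 \<le> c"
  shows "1 \<le> l \<Longrightarrow> \<alpha> \<in> W l c \<Longrightarrow> real (k_last \<alpha>) \<le> \<delta> c * real l"
proof (induction l arbitrary: \<alpha> rule: less_induct)
  case (less l)
  have a: "set \<alpha> \<subseteq> {1, 2}" "count_list \<alpha> 1 = l - 1" "count_list \<alpha> 2 = c - 1"
    using less.prems by (auto simp: W_def)
  show ?case
  proof (cases "c = 1")
    case True
    then show ?thesis using k_last_le_of_no_two[of \<alpha>] a less.prems by (simp add: \<delta>_def)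
  next
    case False
    then have "count_list \<alpha> 2 \<noteq> 0" using a assms by simp
    then have "2 \<in> set \<alpha>" by (metis count_list_0_iff)
    then obtain \<alpha>1 t where "\<alpha> = \<alpha>1 @ [2] @ replicate t 1"
      using last_two_decomp a by blast
    then obtain a0 where a0: "\<alpha> = a0 @ replicate t 1" "last a0 = 2" by (metis append_assoc last_snoc)
    define l0 where "l0 = 1 + count_list a0 1"
    have l0: "l = l0 + t" using a a0 less.prems by (simp add: l0_def count_list_replicate)
    have W0: "a0 \<in> W l0 c"
      using a a0 assms by (subst W_iff) (auto simp: l0_def count_list_replicate)
    obtain j where j: "j < l0" "\<delta>_seq l0 c a0 = real (x_val a0 1 j + \<beta> c a0) / real (j + 1)"
      using \<delta>_seq_attained[of l0] by (auto simp: l0_def)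
    have d0: "\<delta>_seq l0 c a0 \<le> \<delta> c"
      using \<delta>_seq_le_\<delta>[of c l0 a0] W0 a0 False assms by (simp add: l0_def)
    have Xj: "x_val \<alpha> 1 j = x_val a0 1 j"
      unfolding a0(1) by (rule x_val_append) (use j in \<open>simp add: l0_def\<close>)
    have B: "two_cost \<alpha> = \<beta> c a0"
      using \<beta>_eq_two_cost[OF W0] by (simp add: a0(1) two_cost_append_ones)
    have Y: "real (x_val \<alpha> 1 j + two_cost \<alpha>) \<le> \<delta> c * real (j + 1)"
      using d0 unfolding Xj B j(2) by (simp add: field_simps)
    define q where "q = l div (j + 1)"
    define r where "r = l mod (j + 1)"
    have qr: "q * (j + 1) + r = l" unfolding q_def r_def by (rule div_mult_mod_eq)
    have "r < j + 1" by (simp add: r_def)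
    then have r: "r < l" using j l0 by simp
    have X: "real (x_val \<alpha> 1 r) \<le> \<delta> c * real r"
    proof (cases "r = 0")
      case False
      then have "1 \<le> r" "r \<le> count_list \<alpha> 1" using r a by auto
      then obtain \<pi> \<gamma> where p: "\<alpha> = \<pi> @ 1 # \<gamma>" "count_list \<pi> 1 = r - 1" "x_val \<alpha> 1 r = k_last \<pi>"
        by (rule x_val_prefix)
      have "count_list \<pi> 2 \<le> count_list \<alpha> 2" using p by simp
      \<comment> \<open>As \<open>\<pi>\<close> may have fewer than \<open>c - 1\<close> twos, it is
        padded to a member of \<open>W r c\<close>, which can only raise its last size.\<close>
      then have "\<pi> @ replicate (r - 1 - count_list \<pi> 1) 1 @ replicate (c - 1 - count_list \<pi> 2) 2 \<in> W r c"
        using p a False assms by (intro extend_to_W) auto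
      then have "real (k_last (\<pi> @ replicate (r - 1 - count_list \<pi> 1) 1 @
          replicate (c - 1 - count_list \<pi> 2) 2)) \<le> \<delta> c * real r"
        using less.IH[of r] r False by simp
      then show ?thesis using p k_last_append order_trans by (metis of_nat_le_iff)
    qed (simp add: x_val_0)
    have "k_last \<alpha> \<le> q * (x_val \<alpha> 1 (j + 1 - 1) + two_cost \<alpha>) + x_val \<alpha> 1 r"
      using a less.prems r j l0 qr by (intro k_last_periodic_le) auto
    then have "real (k_last \<alpha>) \<le> real (q * (x_val \<alpha> 1 j + two_cost \<alpha>) + x_val \<alpha> 1 r)"
      by (simp only: add_diff_cancel_right' of_nat_le_iff)
    also have "\<dots> = real q * real (x_val \<alpha> 1 j + two_cost \<alpha>) + real (x_val \<alpha> 1 r)"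
      by simp
    also have "\<dots> \<le> real q * (\<delta> c * real (j + 1)) + \<delta> c * real r"
      using Y X by (intro add_mono mult_left_mono) auto
    also have "\<dots> = \<delta> c * real (q * (j + 1) + r)" by (simp add: algebra_simps)
    finally show ?thesis unfolding qr .
  qed
qed

text \<open>Once all twos are used, \<open>j + 1 \<mapsto> x\<^bsub>1,j\<^esub> + \<beta>\<close> is obtained by optimal splitting, so a
  linear lower bound on its initial segment persists.\<close>

lemma k_last_append_ones_ge:
  assumes D: "\<And>j. j \<le> count_list \<alpha> 1 \<Longrightarrow> D * real (j + 1) \<le> real (x_val \<alpha> 1 j + two_cost \<alpha>)"
  shows "D * real (count_list \<alpha> 1 + t + 2) \<le> real (k_last (\<alpha> @ replicate t 1) + two_cost \<alpha>)"
proof -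
  have "D * real (j + 1) \<le> real (x_val (\<alpha> @ replicate t 1) 1 j + two_cost \<alpha>)"
    if "j \<le> count_list \<alpha> 1 + t" for j
    using that
  proof (induction j rule: less_induct)
    case (less j)
    let ?a = "\<alpha> @ replicate t 1"
    show ?case
    proof (cases "j \<le> count_list \<alpha> 1")
      case True
      then show ?thesis using D by (simp add: x_val_append)
    next
      case False
      then have j: "1 \<le> j" "j \<le> count_list ?a 1"
        using less.prems by (auto simp: count_list_replicate)
      then obtain \<pi> \<gamma> where p: "?a = \<pi> @ 1 # \<gamma>" "count_list \<pi> 1 = j - 1" "x_val ?a 1 j = k_last \<pi>"
        by (rule x_val_prefix)
      \<comment> \<open>\<open>\<alpha>\<close> has fewer than \<open>j\<close> ones, so the prefix
        before the \<open>j\<close>-th one contains all of \<open>\<alpha>\<close>, and with it all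
        the twos.\<close>
      have "length \<alpha> \<le> length \<pi>"
      proof (rule ccontr)
        assume "\<not> length \<alpha> \<le> length \<pi>"
        then have "\<alpha> = \<pi> @ 1 # take (length \<alpha> - length \<pi> - 1) \<gamma>"
          using arg_cong[OF p(1), of "take (length \<alpha>)"]
          by (auto simp: take_Cons' One_nat_def split: if_splits)
        then have "count_list \<alpha> 1 \<ge> count_list \<pi> 1 + 1"
          by (metis add.commute add_le_cancel_left count_list.simps(2) count_list_append le_add1)
        then show False using p(2) False by simp
      qed
      then have "\<pi> = \<alpha> @ take (length \<pi> - length \<alpha>) (replicate t 1)"
        using arg_cong[OF p(1), of "take (length \<pi>)"] by simp
      then obtain t' where "\<pi> = \<alpha> @ replicate t' 1" by (metis take_replicate)
      then have tc: "two_cost \<pi> = two_cost \<alpha>" by (simp add: two_cost_append_ones)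
      obtain j1 j2 where s: "j1 + j2 = j - 1"
          "min_split (x_val ?a 1) (j - 1) = x_val ?a 1 j1 + x_val ?a 1 j2"
        by (rule min_split_attained)
      have "k_last \<pi> = two_cost \<alpha> + min_split (x_val \<pi> 1) (j - 1)"
        by (simp add: k_last_eq tc p)
      also have "min_split (x_val \<pi> 1) (j - 1) = min_split (x_val ?a 1) (j - 1)"
        unfolding p(1) using p(2) by (simp add: min_split_x_val_append)
      finally have k: "x_val ?a 1 j = two_cost \<alpha> + (x_val ?a 1 j1 + x_val ?a 1 j2)"
        using s p by simp
      have "D * real (j + 1) = D * real (j1 + 1) + D * real (j2 + 1)"
      proof -
        have "real (j + 1) = real (j1 + 1) + real (j2 + 1)" using s j by linarith
        then show ?thesis by (simp only: distrib_left)
      qed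
      also have "\<dots> \<le> real (x_val ?a 1 j1 + two_cost \<alpha>) + real (x_val ?a 1 j2 + two_cost \<alpha>)"
        using s j less.prems by (intro add_mono less.IH) auto
      also have "\<dots> = real (x_val ?a 1 j + two_cost \<alpha>)" by (simp add: k)
      finally show ?thesis .
    qed
  qed
  note X = this
  let ?a = "\<alpha> @ replicate t 1"
  have n: "count_list ?a 1 = count_list \<alpha> 1 + t" by (simp add: count_list_replicate)
  obtain j1 j2 where s: "j1 + j2 = count_list \<alpha> 1 + t"
      "min_split (x_val ?a 1) (count_list \<alpha> 1 + t) = x_val ?a 1 j1 + x_val ?a 1 j2"
    by (rule min_split_attained)
  have k: "k_last ?a = two_cost \<alpha> + (x_val ?a 1 j1 + x_val ?a 1 j2)"
    by (simp only: k_last_eq n s two_cost_append_ones)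
  \<comment> \<open>\<open>k_last\<close> contains the cost of the twos once. A second copy gives
    each arm its own, and the arms get weights \<open>j1 + 1\<close> and \<open>j2 + 1\<close>;
    hence the 2.\<close>
  have "real (count_list \<alpha> 1 + t + 2) = real (j1 + 1) + real (j2 + 1)"
    using s by simp
  then have "D * real (count_list \<alpha> 1 + t + 2) = D * real (j1 + 1) + D * real (j2 + 1)"
    by (simp only: distrib_left)
  also have "\<dots> \<le> real (x_val ?a 1 j1 + two_cost \<alpha>) + real (x_val ?a 1 j2 + two_cost \<alpha>)"
    using s by (intro add_mono X) auto
  also have "\<dots> = real (k_last ?a + two_cost \<alpha>)" by (simp add: k)
  finally show ?thesis .
qed

section \<open>Boards\<close>

text \<open>Boards are arbitrary records; this invariant guarantees that vertex
  \<open>nverts B\<close> is isolated before it is added.\<close>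

definition wf_board :: "board \<Rightarrow> bool" where
  "wf_board B \<longleftrightarrow> (\<forall>u v. {u, v} \<in> edges B \<longrightarrow> u \<in> verts B \<and> v \<in> verts B)"

definition mono_path :: "board \<Rightarrow> nat \<Rightarrow> nat list \<Rightarrow> bool" where
  "mono_path B s p \<longleftrightarrow> is_path B p \<and> (\<forall>v\<in>set p. colour B v = s)"

lemma nverts_add_vertex [simp]: "nverts (add_vertex B U s) = Suc (nverts B)"
  and colour_add_vertex [simp]: "colour (add_vertex B U s) = (colour B)(nverts B := s)"
  by (simp_all add: add_vertex_def)

lemma verts_add_vertex [simp]: "verts (add_vertex B U s) = insert (nverts B) (verts B)"
  by (auto simp: verts_def)

lemma nverts_notin [simp]: "nverts B \<notin> verts B"
  by (simp add: verts_def)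

lemma finite_verts [simp]: "finite (verts B)"
  by (simp add: verts_def)

lemma edge_add_vertex:
  "{x, y} \<in> edges (add_vertex B U s) \<longleftrightarrow>
     {x, y} \<in> edges B \<or> (x \<in> U \<and> y = nverts B) \<or> (y \<in> U \<and> x = nverts B)"
  by (auto simp: add_vertex_def doubleton_eq_iff)

lemma wf_board_edge: "wf_board B \<Longrightarrow> {x, y} \<in> edges B \<Longrightarrow> x \<in> verts B \<and> y \<in> verts B"
  unfolding wf_board_def by blast

lemma wf_board_empty [simp]: "wf_board empty_board"
  by (simp add: wf_board_def empty_board_def)

lemma wf_board_add_vertex: "wf_board B \<Longrightarrow> U \<subseteq> verts B \<Longrightarrow> wf_board (add_vertex B U s)"
  unfolding wf_board_def by (auto simp: edge_add_vertex)

section \<open>Connected components\<close>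

lemma component_refl [simp]: "v \<in> component B v"
  by (simp add: component_def)

lemma component_step: "u \<in> component B v \<Longrightarrow> {u, w} \<in> edges B \<Longrightarrow> w \<in> component B v"
  unfolding component_def by (auto intro: rtrancl_into_rtrancl)

lemma component_induct [consumes 1, case_names refl step]:
  assumes "u \<in> component B v" "P v"
    and "\<And>x y. x \<in> component B v \<Longrightarrow> P x \<Longrightarrow> {x, y} \<in> edges B \<Longrightarrow> P y"
  shows "P u"
proof -
  have "(v, u) \<in> {(x, y). {x, y} \<in> edges B}\<^sup>*" using assms(1) by (simp add: component_def)
  then show ?thesis
  proof (induction rule: rtrancl_induct)
    case (step x y)
    then show ?case using assms(3)[of x y] by (simp add: component_def)
  qed (rule assms(2))
qed

lemma component_trans: "u \<in> component B v \<Longrightarrow> w \<in> component B u \<Longrightarrow> w \<in> component B v"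
  unfolding component_def by auto

lemma component_sym: "u \<in> component B v \<Longrightarrow> v \<in> component B u"
proof (induction rule: component_induct)
  case (step x y)
  then show ?case
    using component_step[of y B y x] component_trans by (metis component_refl insert_commute)
qed simp

lemma component_eq: "u \<in> component B v \<Longrightarrow> component B u = component B v"
  using component_sym component_trans by blast

lemma component_disjoint:
  "component B u \<noteq> component B v \<Longrightarrow> component B u \<inter> component B v = {}"
  using component_eq by blast

lemma component_subset_verts:
  assumes "wf_board B" "v \<in> verts B"
  shows "component B v \<subseteq> verts B"
proof
  fix u assume "u \<in> component B v"
  then show "u \<in> verts B"
    by (induction rule: component_induct) (simp add: assms, use assms(1) wf_board_edge in blast)
qed

lemma finite_component: "wf_board B \<Longrightarrow> v \<in> verts B \<Longrightarrow> finite (component B v)"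
  using component_subset_verts finite_verts finite_subset by metis

lemma component_add_vertex_mono: "component B v \<subseteq> component (add_vertex B U s) v"
proof
  fix u assume "u \<in> component B v"
  then show "u \<in> component (add_vertex B U s) v"
    by (induction rule: component_induct) (auto intro: component_step simp: edge_add_vertex)
qed

lemma component_add_vertex_new:
  assumes "wf_board B" "U \<subseteq> verts B"
  shows "component (add_vertex B U s) (nverts B) = insert (nverts B) (\<Union>u\<in>U. component B u)"
proof (intro equalityI subsetI)
  fix x assume "x \<in> component (add_vertex B U s) (nverts B)"
  then show "x \<in> insert (nverts B) (\<Union>u\<in>U. component B u)"
  proof (induction rule: component_induct)
    case (step x y)
    from step.hyps(2) consider "{x, y} \<in> edges B" | "x \<in> U" "y = nverts B" | "y \<in> U"
      by (auto simp: edge_add_vertex)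
    then show ?case
    proof cases
      case 1
      then have "x \<noteq> nverts B" using wf_board_edge[OF assms(1)] nverts_notin by metis
      then show ?thesis using step.IH 1 component_step by blast
    qed (use component_refl in blast)+
  qed simp
next
  fix x assume "x \<in> insert (nverts B) (\<Union>u\<in>U. component B u)"
  then consider "x = nverts B" | u where "u \<in> U" "x \<in> component B u" by auto
  then show "x \<in> component (add_vertex B U s) (nverts B)"
  proof cases
    case 2
    then have "u \<in> component (add_vertex B U s) (nverts B)"
      by (intro component_step[OF component_refl]) (simp add: edge_add_vertex)
    then show ?thesis using 2 component_add_vertex_mono component_trans by blast
  qed simp
qed

lemma component_add_vertex_old:
  assumes "wf_board B" "U \<subseteq> verts B" "w \<in> verts B" "w \<notin> (\<Union>u\<in>U. component B u)"
  shows "component (add_vertex B U s) w = component B w"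
proof
  show "component (add_vertex B U s) w \<subseteq> component B w"
  proof
    fix x assume "x \<in> component (add_vertex B U s) w"
    then show "x \<in> component B w"
    proof (induction rule: component_induct)
      case (step x y)
      have "x \<notin> U" using step.IH assms(4) component_sym by blast
      moreover have "x \<noteq> nverts B"
        using step.IH component_subset_verts[OF assms(1,3)] nverts_notin by blast
      ultimately have "{x, y} \<in> edges B" using step.hyps(2) by (auto simp: edge_add_vertex)
      then show ?case using step.IH component_step by blast
    qed simp
  qed
qed (rule component_add_vertex_mono)

section \<open>Paths and cycles when a vertex is added\<close>

lemma path_in_component:
  assumes "successively (\<lambda>u v. {u, v} \<in> edges B) p" "x \<in> set p"
  shows "x \<in> component B (hd p)"
proof -
  have "\<forall>x\<in>set p. x \<in> component B (hd p)"
    using assms(1)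
  proof (induction p rule: rev_induct)
    case (snoc a p)
    show ?case
    proof (cases "p = []")
      case False
      then have "last p \<in> component B (hd p)" "{last p, a} \<in> edges B"
        using snoc by (auto simp: successively_append_iff)
      then have "a \<in> component B (hd p)" by (rule component_step)
      then show ?thesis using snoc False by (auto simp: successively_append_iff)
    qed simp
  qed simp
  then show ?thesis using assms(2) by blast
qed

lemma successively_rev_edges:
  "successively (\<lambda>u v. {u, v} \<in> E) (rev p) \<longleftrightarrow> successively (\<lambda>u v. {u, v} \<in> E) p"
  by (simp add: insert_commute)

lemma ex_path_of_component:
  assumes "wf_board B" "v \<in> verts B" "u \<in> component B v"
  obtains p where "is_path B p" "hd p = v" "last p = u"
proof -
  have "\<exists>p. is_path B p \<and> hd p = v \<and> last p = u"
    using assms(3)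
  proof (induction rule: component_induct)
    case refl
    then show ?case using assms(2) by (intro exI[of _ "[v]"]) (simp add: is_path_def)
  next
    case (step x y)
    then obtain p where p: "is_path B p" "hd p = v" "last p = x" by blast
    show ?case
    \<comment> \<open>If \<open>y\<close> already lies on the path, the initial segment up to
      \<open>y\<close> serves; otherwise \<open>y\<close> is appended.\<close>
    proof (cases "y \<in> set p")
      case True
      then obtain p1 p2 where "p = p1 @ y # p2" by (metis split_list)
      then have "is_path B (p1 @ [y])" "hd (p1 @ [y]) = v"
        using p by (auto simp: is_path_def successively_append_iff hd_append successively_Cons split: if_splits)
      then show ?thesis by (intro exI[of _ "p1 @ [y]"]) simp
    next
      case False
      then have "is_path B (p @ [y])" "hd (p @ [y]) = v"
        using p step.hyps(2) wf_board_edge[OF assms(1) step.hyps(2)]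
        by (auto simp: is_path_def successively_append_iff)
      then show ?thesis by (intro exI[of _ "p @ [y]"]) simp
    qed
  qed
  then show ?thesis using that by blast
qed

lemma is_path_add_vertex_old:
  assumes "wf_board B" "U \<subseteq> verts B" "nverts B \<notin> set p"
  shows "is_path (add_vertex B U s) p \<longleftrightarrow> is_path B p"
proof -
  have "successively (\<lambda>u v. {u, v} \<in> edges (add_vertex B U s)) p
      \<longleftrightarrow> successively (\<lambda>u v. {u, v} \<in> edges B) p"
    using assms(3) by (intro successively_cong) (auto simp: edge_add_vertex)
  then show ?thesis using assms(3) by (auto simp: is_path_def)
qed

text \<open>The two arms \<open>p\<close> and \<open>q\<close> of a path through the new vertex may be empty.\<close>

lemma is_path_add_vertex_iff:
  assumes "wf_board B" "U \<subseteq> verts B"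
  shows "is_path (add_vertex B U s) (p @ nverts B # q) \<longleftrightarrow>
     (p \<noteq> [] \<longrightarrow> is_path B p \<and> last p \<in> U) \<and> (q \<noteq> [] \<longrightarrow> is_path B q \<and> hd q \<in> U) \<and>
     set p \<inter> set q = {}" (is "?L \<longleftrightarrow> ?R")
proof -
  let ?B = "add_vertex B U s" and ?v = "nverts B"
  have e: "{x, ?v} \<in> edges ?B \<longleftrightarrow> x \<in> U" "{?v, x} \<in> edges ?B \<longleftrightarrow> x \<in> U" for x
    using assms wf_board_edge[OF assms(1), of x ?v] wf_board_edge[OF assms(1), of ?v x]
    by (auto simp: edge_add_vertex)
  have old: "is_path ?B r \<longleftrightarrow> is_path B r" if "?v \<notin> set r" for r
    using is_path_add_vertex_old[OF assms that] .
  have notin: "is_path B r \<Longrightarrow> ?v \<notin> set r" for r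
    using nverts_notin unfolding is_path_def by blast
  have ?L if ?R
  proof -
    have "?v \<notin> set p" "?v \<notin> set q" using that notin by (cases "p = []"; cases "q = []"; auto)+
    moreover have "p \<noteq> [] \<Longrightarrow> is_path ?B p" "q \<noteq> [] \<Longrightarrow> is_path ?B q"
      using that old calculation by auto
    ultimately show ?L using that unfolding is_path_def
      by (cases "p = []"; cases "q = []") (auto simp: successively_append_iff successively_Cons e)
  qed
  moreover have ?R if ?L
  proof -
    have v: "?v \<notin> set p" "?v \<notin> set q" using that by (auto simp: is_path_def)
    have "p \<noteq> [] \<Longrightarrow> is_path ?B p \<and> last p \<in> U" "q \<noteq> [] \<Longrightarrow> is_path ?B q \<and> hd q \<in> U"
      using that v by (auto simp: is_path_def successively_append_iff successively_Cons e)
    then show ?R using old v that by (auto simp: is_path_def)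
  qed
  ultimately show ?thesis by blast
qed

lemma is_path_append:
  assumes "is_path B p" "is_path B q" "set p \<inter> set q = {}" "{last p, hd q} \<in> edges B"
  shows "is_path B (p @ q)"
  using assms by (auto simp: is_path_def successively_append_iff)

text \<open>A path between two neighbours of the new vertex inside one old component would close to
  a cycle through the new vertex.\<close>

lemma forest_add_vertex_imp_components_ne:
  assumes "wf_board B" "U \<subseteq> verts B" "is_forest (add_vertex B U s)"
    and "u \<in> U" "w \<in> U" "u \<noteq> w"
  shows "component B u \<noteq> component B w"
proof
  assume "component B u = component B w"
  then have "w \<in> component B u" by simp
  then obtain p where p: "is_path B p" "hd p = u" "last p = w"
    using ex_path_of_component assms by blast
  then have "2 \<le> length p"
    using assms(6) by (cases p rule: remdups_adj.cases) (auto simp: is_path_def)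
  moreover have "is_path (add_vertex B U s) ([] @ nverts B # p)"
    using p assms by (subst is_path_add_vertex_iff) auto
  moreover have "{w, nverts B} \<in> edges (add_vertex B U s)"
    using assms by (simp add: edge_add_vertex)
  ultimately have "is_cycle (add_vertex B U s) (nverts B # p)"
    using p by (auto simp: is_cycle_def is_path_def)
  then show False using assms(3) unfolding is_forest_def by blast
qed

text \<open>Conversely, deleting the new vertex from a cycle through it leaves a path between two
  distinct neighbours, which then share a component.\<close>

lemma is_forest_add_vertex:
  assumes "wf_board B" "U \<subseteq> verts B" "is_forest B"
    and ne: "\<And>u w. u \<in> U \<Longrightarrow> w \<in> U \<Longrightarrow> u \<noteq> w \<Longrightarrow> component B u \<noteq> component B w"
  shows "is_forest (add_vertex B U s)"
  unfolding is_forest_def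
proof
  let ?B = "add_vertex B U s" and ?v = "nverts B"
  assume "\<exists>c. is_cycle ?B c"
  then obtain c where c: "is_path ?B c" "3 \<le> length c" "{last c, hd c} \<in> edges ?B"
    unfolding is_cycle_def by blast
  show False
  proof (cases "?v \<in> set c")
    case False
    then have "is_path B c" using is_path_add_vertex_old[OF assms(1,2)] c by blast
    moreover have "last c \<noteq> ?v" "hd c \<noteq> ?v" using False c(2) hd_in_set[of c] last_in_set[of c] by fastforce+
    then have "{last c, hd c} \<in> edges B" using c(3) by (auto simp: edge_add_vertex)
    ultimately show False using assms(3) c(2) unfolding is_forest_def is_cycle_def by blast
  next
    case True
    then obtain p q where pq: "c = p @ ?v # q" by (metis split_list)
    have "is_path ?B (p @ ?v # q)" using c(1) pq by simp
    then have r: "p \<noteq> [] \<Longrightarrow> is_path B p \<and> last p \<in> U" "q \<noteq> [] \<Longrightarrow> is_path B q \<and> hd q \<in> U"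
        "set p \<inter> set q = {}"
      using is_path_add_vertex_iff[OF assms(1,2)] by blast+
    have e: "{x, ?v} \<in> edges ?B \<longleftrightarrow> x \<in> U" "{?v, x} \<in> edges ?B \<longleftrightarrow> x \<in> U" for x
      using assms wf_board_edge[OF assms(1), of x ?v] wf_board_edge[OF assms(1), of ?v x]
      by (auto simp: edge_add_vertex)
    \<comment> \<open>The cycle is a list cut open at an arbitrary place, so the remaining path is
      \<open>q @ p\<close>, joined by the closing edge of the cycle.\<close>
    have "\<exists>r. is_path B r \<and> 2 \<le> length r \<and> hd r \<in> U \<and> last r \<in> U"
    proof (cases "p = []"; cases "q = []")
      assume "p = []" "q \<noteq> []"
      then show ?thesis using r c pq by (intro exI[of _ q]) (auto simp: e)
    next
      assume "p \<noteq> []" "q = []"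
      then show ?thesis using r c pq by (intro exI[of _ p]) (auto simp: e)
    next
      assume ne: "p \<noteq> []" "q \<noteq> []"
      have pv: "?v \<notin> set p" "?v \<notin> set q" using c(1) pq by (auto simp: is_path_def)
      then have "last q \<noteq> ?v" "hd p \<noteq> ?v" using ne hd_in_set[of p] last_in_set[of q] by fastforce+
      then have "{last q, hd p} \<in> edges B" using c(3) pq ne by (auto simp: edge_add_vertex)
      then have "is_path B (q @ p)" using r ne by (intro is_path_append) auto
      then show ?thesis using r ne c pq by (intro exI[of _ "q @ p"]) auto
    qed (use c pq in auto)
    then obtain r where r: "is_path B r" "2 \<le> length r" "hd r \<in> U" "last r \<in> U" by blast
    have "hd r \<noteq> last r"
      using r(1,2) by (cases r) (auto simp: is_path_def split: if_splits)
    moreover have "last r \<in> component B (hd r)"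
      using r(1) by (intro path_in_component) (auto simp: is_path_def)
    ultimately show False using ne[OF r(3,4)] component_eq by metis
  qed
qed

section \<open>Painter's strategy\<close>

text \<open>Painter's invariant. The bound on the length keeps the game alive; the bound on the
  component size forces Builder to pay for every path.\<close>

definition safe :: "nat list \<Rightarrow> board \<Rightarrow> bool" where
  "safe \<alpha> B \<longleftrightarrow> (\<forall>s\<in>{1, 2}. \<forall>p. mono_path B s p \<longrightarrow>
     length p \<le> count_list \<alpha> s \<and> x_val \<alpha> s (length p) \<le> card (component B (hd p)))"

lemma safe_empty: "safe \<alpha> empty_board"
  by (auto simp: safe_def mono_path_def is_path_def verts_def empty_board_def)

lemma safe_imp_not_lost:
  assumes "safe \<alpha> B" "count_list \<alpha> 1 < l" "count_list \<alpha> 2 < c"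
  shows "\<not> painter_lost l c B"
  using assms by (fastforce simp: safe_def painter_lost_def has_mono_path_def mono_path_def)

text \<open>\<open>p\<close> and \<open>q\<close> are the two arms, starting at the new vertex, of a path that violates safety.\<close>

lemma unsafe_colour_arms:
  assumes wf: "wf_board B" "U \<subseteq> verts B" and "safe \<alpha> B" "s \<in> {1, 2}"
    and bad: "\<not> safe \<alpha> (add_vertex B U s)"
  obtains p q where
    "p = [] \<or> mono_path B s p \<and> hd p \<in> U" "q = [] \<or> mono_path B s q \<and> hd q \<in> U"
    "set p \<inter> set q = {}"
    "count_list \<alpha> s < Suc (length p + length q) \<or>
     card (component (add_vertex B U s) (nverts B)) < x_val \<alpha> s (Suc (length p + length q))"
proof -
  let ?B = "add_vertex B U s" and ?v = "nverts B"
  obtain t r where t: "t \<in> {1, 2}" and r: "mono_path ?B t r"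
    and viol: "count_list \<alpha> t < length r \<or> card (component ?B (hd r)) < x_val \<alpha> t (length r)"
    using bad unfolding safe_def by (meson not_le)
  have hd: "hd r \<in> verts ?B" using r hd_in_set unfolding mono_path_def is_path_def by blast
  have fin: "finite (component ?B (hd r))"
    using finite_component[OF wf_board_add_vertex[OF wf]] hd .
  \<comment> \<open>A path that avoids the new vertex stays harmless, because components only
    grow.\<close>
  have "?v \<in> set r"
  proof (rule ccontr)
    assume "?v \<notin> set r"
    then have "mono_path B t r"
      using r is_path_add_vertex_old[OF wf] by (auto simp: mono_path_def split: if_splits)
    then have "length r \<le> count_list \<alpha> t" "x_val \<alpha> t (length r) \<le> card (component B (hd r))"
      using \<open>safe \<alpha> B\<close> t unfolding safe_def by blast+
    moreover have "card (component B (hd r)) \<le> card (component ?B (hd r))"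
      using fin component_add_vertex_mono by (rule card_mono)
    ultimately show False using viol by linarith
  qed
  then obtain p q where pq: "r = p @ ?v # q" by (metis split_list)
  have ts: "t = s" using r \<open>?v \<in> set r\<close> by (auto simp: mono_path_def)
  have "is_path ?B (p @ ?v # q)" using r unfolding pq mono_path_def by blast
  then have arms: "p \<noteq> [] \<Longrightarrow> is_path B p \<and> last p \<in> U" "q \<noteq> [] \<Longrightarrow> is_path B q \<and> hd q \<in> U"
      "set p \<inter> set q = {}" "?v \<notin> set p" "?v \<notin> set q"
    using is_path_add_vertex_iff[OF wf] by (auto simp: is_path_def)
  have col: "\<forall>x\<in>set p \<union> set q. colour B x = s"
  proof
    fix x assume x: "x \<in> set p \<union> set q"
    then have "colour ?B x = s" using r pq ts unfolding mono_path_def by auto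
    moreover have "x \<noteq> ?v" using x arms(4,5) by auto
    ultimately show "colour B x = s" by simp
  qed
  have "?v \<in> component ?B (hd r)"
    using r \<open>?v \<in> set r\<close> unfolding mono_path_def is_path_def by (intro path_in_component) auto
  then have "component ?B (hd r) = component ?B ?v" using component_eq by blast
  moreover have "length r = Suc (length (rev p) + length q)" using pq by simp
  moreover have "p = [] \<or> mono_path B s (rev p) \<and> hd (rev p) \<in> U"
    using arms(1) col successively_rev_edges[of "edges B" p]
    by (auto simp: mono_path_def is_path_def hd_rev)
  moreover have "q = [] \<or> mono_path B s q \<and> hd q \<in> U"
    using arms(2) col by (auto simp: mono_path_def)
  ultimately show ?thesis
    using that[of "rev p" q] arms(3) viol ts by auto
qed

text \<open>Disjoint nonempty arms start at distinct neighbours, which lie in different components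
  because the new board is a forest; so their sizes add up.\<close>

lemma arms_cost:
  assumes wf: "wf_board B" "U \<subseteq> verts B" and "safe \<alpha> B" "s \<in> {1, 2}"
    and forest: "is_forest (add_vertex B U t)"
    and p: "p = [] \<or> mono_path B s p \<and> hd p \<in> U" and q: "q = [] \<or> mono_path B s q \<and> hd q \<in> U"
    and disj: "set p \<inter> set q = {}"
  shows "x_val \<alpha> s (length p) + x_val \<alpha> s (length q)
      \<le> card (\<Union>u\<in>{u \<in> U. colour B u = s}. component B u)"
    "length p \<le> count_list \<alpha> s" "length q \<le> count_list \<alpha> s"
proof -
  have fin: "finite (component B u)" if "u \<in> U" for u
    using finite_component wf that by blast
  have finU: "finite {u \<in> U. colour B u = s}" using wf(2) finite_verts finite_subset by fastforce
  \<comment> \<open>An empty arm is charged the empty set, in accordance with the entry 0 at index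
    0.\<close>
  define C where "C r = (if r = [] then {} else component B (hd r))" for r
  have C: "finite (C r)" "C r \<subseteq> (\<Union>u\<in>{u \<in> U. colour B u = s}. component B u)"
      "x_val \<alpha> s (length r) \<le> card (C r)" "length r \<le> count_list \<alpha> s"
    if "r = [] \<or> mono_path B s r \<and> hd r \<in> U" for r
    using that \<open>safe \<alpha> B\<close> \<open>s \<in> {1, 2}\<close> fin
    by (auto simp: C_def x_val_0 safe_def mono_path_def is_path_def)
  have "C p \<inter> C q = {}"
  proof (cases "p = [] \<or> q = []")
    case False
    then have "hd p \<noteq> hd q" using disj by (metis disjoint_iff hd_in_set)
    then show ?thesis
      using False p q forest_add_vertex_imp_components_ne[OF wf forest] component_disjoint
      by (metis C_def)
  qed (auto simp: C_def)
  then have "card (C p) + card (C q) = card (C p \<union> C q)"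
    using C(1) p q by (simp add: card_Un_disjoint)
  also have "\<dots> \<le> card (\<Union>u\<in>{u \<in> U. colour B u = s}. component B u)"
    using C(2)[OF p] C(2)[OF q] finU fin by (intro card_mono) auto
  finally show "x_val \<alpha> s (length p) + x_val \<alpha> s (length q)
      \<le> card (\<Union>u\<in>{u \<in> U. colour B u = s}. component B u)"
    using C(3)[OF p] C(3)[OF q] by linarith
  show "length p \<le> count_list \<alpha> s" "length q \<le> count_list \<alpha> s" using C(4) p q by blast+
qed

text \<open>If both colours were unsafe, the arms of both violations would fit disjointly into the
  merged component of \<open>N \<le> k\<close> vertices. By \<open>affordable_colour\<close> one
  violation then disappears, or the arms cost \<open>k_last \<alpha> > k\<close>.\<close>

lemma safe_colour_exists:
  assumes wf: "wf_board B" "U \<subseteq> verts B" and safe: "safe \<alpha> B"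
    and adm: "\<And>s. s \<in> {1, 2} \<Longrightarrow> admissible k (add_vertex B U s)" and "k < k_last \<alpha>"
  shows "\<exists>s\<in>{1, 2}. safe \<alpha> (add_vertex B U s)"
proof (rule ccontr)
  let ?v = "nverts B"
  assume "\<not> ?thesis"
  then have bad: "\<not> safe \<alpha> (add_vertex B U s)" if "s \<in> {1, 2}" for s using that by blast
  define N where "N = card (insert ?v (\<Union>u\<in>U. component B u))"
  have N: "card (component (add_vertex B U s) ?v) = N" for s
    unfolding N_def component_add_vertex_new[OF wf] ..
  have forest: "is_forest (add_vertex B U 1)" using adm[of 1] by (simp add: admissible_def)
  have Nk: "N \<le> k" using adm[of 1] N[of 1] by (auto simp: admissible_def)
  define V where "V s = (\<Union>u\<in>{u \<in> U. colour B u = s}. component B u)" for s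
  have fin: "finite (component B u)" "component B u \<subseteq> verts B" if "u \<in> U" for u
    using finite_component component_subset_verts wf that by blast+
  have finU: "finite U" using wf(2) finite_verts finite_subset by blast
  have "V 1 \<inter> V 2 = {}"
  proof -
    have "component B u \<inter> component B w = {}" if "u \<in> U" "w \<in> U" "colour B u = 1" "colour B w = 2" for u w
    proof -
      have "u \<noteq> w" using that by auto
      then show ?thesis
        using forest_add_vertex_imp_components_ne[OF wf forest] that component_disjoint by metis
    qed
    then show ?thesis unfolding V_def by blast
  qed
  moreover have finV: "finite (V s)" for s using fin finU by (simp add: V_def)
  ultimately have "card (V 1) + card (V 2) = card (V 1 \<union> V 2)" by (simp add: card_Un_disjoint)
  moreover have "?v \<notin> V 1 \<union> V 2" unfolding V_def using fin(2) nverts_notin by blast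
  then have "Suc (card (V 1 \<union> V 2)) = card (insert ?v (V 1 \<union> V 2))" using finV by simp
  moreover have "\<dots> \<le> N"
    unfolding N_def using fin finU by (intro card_mono) (auto simp: V_def)
  ultimately have cardN: "1 + card (V 1) + card (V 2) \<le> N" by simp
  have arms: "\<exists>a. a \<le> count_list \<alpha> s \<and> min_split (x_val \<alpha> s) a \<le> card (V s) \<and>
      (a < count_list \<alpha> s \<longrightarrow> N < x_val \<alpha> s (Suc a))" if s: "s \<in> {1, 2}" for s
  proof -
    obtain p q where pq: "p = [] \<or> mono_path B s p \<and> hd p \<in> U" "q = [] \<or> mono_path B s q \<and> hd q \<in> U"
      "set p \<inter> set q = {}"
      and viol: "count_list \<alpha> s < Suc (length p + length q) \<or> N < x_val \<alpha> s (Suc (length p + length q))"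
      using unsafe_colour_arms[OF wf safe s bad[OF s]] unfolding N by metis
    note cost = arms_cost[OF wf safe s forest pq]
    \<comment> \<open>The arms together may exceed the range of the array, so their length is
      capped; monotonicity keeps the cost bound valid.\<close>
    define a where "a = min (length p + length q) (count_list \<alpha> s)"
    have "min_split (x_val \<alpha> s) a \<le> x_val \<alpha> s (length p) + x_val \<alpha> s (length q)"
      using cost(2,3) x_val_mono by (intro min_split_le_of_mono[of "count_list \<alpha> s"]) (auto simp: a_def)
    then have "min_split (x_val \<alpha> s) a \<le> card (V s)" using cost(1) by (simp add: V_def)
    then show ?thesis using viol by (intro exI[of _ a]) (auto simp: a_def min_def)
  qed
  obtain a where a: "a \<le> count_list \<alpha> 1" "min_split (x_val \<alpha> 1) a \<le> card (V 1)"
      "a < count_list \<alpha> 1 \<longrightarrow> N < x_val \<alpha> 1 (Suc a)"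
    using arms[of 1] by auto
  obtain b where b: "b \<le> count_list \<alpha> 2" "min_split (x_val \<alpha> 2) b \<le> card (V 2)"
      "b < count_list \<alpha> 2 \<longrightarrow> N < x_val \<alpha> 2 (Suc b)"
    using arms[of 2] by auto
  define S where "S = 1 + min_split (x_val \<alpha> 1) a + min_split (x_val \<alpha> 2) b"
  have "S \<le> N" using a(2) b(2) cardN by (simp add: S_def)
  moreover have "(a < count_list \<alpha> 1 \<and> x_val \<alpha> 1 (Suc a) \<le> S) \<or>
     (b < count_list \<alpha> 2 \<and> x_val \<alpha> 2 (Suc b) \<le> S) \<or> S = k_last \<alpha>"
    using affordable_colour[OF a(1) b(1)] by (auto simp: S_def Let_def k_last_eq_sum)
  ultimately show False using a(3) b(3) Nk \<open>k < k_last \<alpha>\<close> by auto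
qed

lemma safe_imp_not_forces:
  assumes "count_list \<alpha> 1 < l" "count_list \<alpha> 2 < c" "k < k_last \<alpha>"
  shows "wf_board B \<Longrightarrow> safe \<alpha> B \<Longrightarrow> \<not> forces_within k l c n B"
proof (induction n arbitrary: B)
  case 0
  then show ?case using safe_imp_not_lost assms by simp
next
  case (Suc n)
  show ?case
  proof
    assume "forces_within k l c (Suc n) B"
    then obtain U where U: "U \<subseteq> verts B"
      "\<forall>s\<in>{1, 2}. admissible k (add_vertex B U s) \<and> forces_within k l c n (add_vertex B U s)"
      using safe_imp_not_lost[OF Suc.prems(2) assms(1,2)] by auto
    obtain s where "s \<in> {1, 2}" "safe \<alpha> (add_vertex B U s)"
      using safe_colour_exists[OF Suc.prems(1) U(1) Suc.prems(2) _ assms(3)] U(2) by blast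
    then show False using Suc.IH wf_board_add_vertex[OF Suc.prems(1) U(1)] U(2) by blast
  qed
qed

lemma builder_wins_imp_k_last_le:
  assumes "builder_wins k l c" "1 \<le> l" "1 \<le> c" "\<alpha> \<in> W l c"
  shows "k_last \<alpha> \<le> k"
proof (rule ccontr)
  assume "\<not> k_last \<alpha> \<le> k"
  then have "\<not> forces_within k l c n empty_board" for n
    using assms(2-4) safe_empty[of \<alpha>]
    by (intro safe_imp_not_forces) (auto simp: W_def)
  then show False using assms(1) unfolding builder_wins_def by blast
qed

section \<open>Builder's strategy\<close>

text \<open>Builder can force \<open>G\<close> in finitely many moves. Not tracking their number
  makes successive phases easy to compose.\<close>

inductive reach :: "nat \<Rightarrow> (board \<Rightarrow> bool) \<Rightarrow> board \<Rightarrow> bool" for k G where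
  here: "G B \<Longrightarrow> reach k G B"
| move: "U \<subseteq> verts B \<Longrightarrow>
    (\<And>s. s \<in> {1, 2} \<Longrightarrow> admissible k (add_vertex B U s) \<and> reach k G (add_vertex B U s)) \<Longrightarrow>
    reach k G B"

lemma reach_trans:
  assumes "reach k G B" "\<And>B. G B \<Longrightarrow> reach k H B"
  shows "reach k H B"
  using assms(1)
proof induction
  case (move U B)
  then show ?case by (intro reach.move[of U]) auto
qed (rule assms(2))

lemma forces_within_Suc: "forces_within k l c n B \<Longrightarrow> forces_within k l c (Suc n) B"
proof (induction n arbitrary: B)
  case (Suc n)
  from Suc.prems consider "painter_lost l c B"
    | U where "U \<subseteq> verts B"
      "\<forall>s\<in>{1, 2}. admissible k (add_vertex B U s) \<and> forces_within k l c n (add_vertex B U s)"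
    by auto
  then show ?case
  proof cases
    case (2 U)
    then have "\<forall>s\<in>{1, 2}. admissible k (add_vertex B U s) \<and>
        forces_within k l c (Suc n) (add_vertex B U s)"
      using Suc.IH by blast
    then show ?thesis using 2(1) unfolding forces_within.simps(2)[of _ _ _ "Suc n"] by blast
  qed simp
qed simp

lemma forces_within_mono: "n \<le> m \<Longrightarrow> forces_within k l c n B \<Longrightarrow> forces_within k l c m B"
  by (induction m rule: dec_induct) (auto intro: forces_within_Suc simp del: forces_within.simps)

text \<open>Painter has only two answers, so the maximum of the two bounds serves at each
  move.\<close>

lemma reach_lost_imp_forces:
  assumes "reach k (painter_lost l c) B"
  shows "\<exists>n. forces_within k l c n B"
  using assms
proof induction
  case (here B)
  then show ?case by (intro exI[of _ 0]) simp
next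
  case (move U B)
  have adm: "admissible k (add_vertex B U s)" if "s \<in> {1, 2}" for s
    using move(2)[OF that] by blast
  have ex: "\<exists>n. forces_within k l c n (add_vertex B U s)" if "s \<in> {1, 2}" for s
    using move(2)[OF that] by blast
  obtain n1 n2 where n: "forces_within k l c n1 (add_vertex B U 1)"
    "forces_within k l c n2 (add_vertex B U 2)" using ex[of 1] ex[of 2] by auto
  have "forces_within k l c (max n1 n2) (add_vertex B U s)" if "s \<in> {1, 2}" for s
    using that n forces_within_mono[OF max.cobounded1] forces_within_mono[OF max.cobounded2] by auto
  then have "forces_within k l c (Suc (max n1 n2)) B"
    unfolding forces_within.simps(2) using move(1) adm by blast
  then show ?case by blast
qed

text \<open>Components are counted instead of paths, since attaching a path uses up its whole
  component.\<close>

definition avail :: "board \<Rightarrow> nat \<Rightarrow> nat \<Rightarrow> nat \<Rightarrow> nat set set" where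
  "avail B s j x =
     {component B (hd p) | p. mono_path B s p \<and> length p = j \<and> card (component B (hd p)) \<le> x}"

lemma mono_path_hd: "mono_path B s p \<Longrightarrow> p \<noteq> [] \<and> hd p \<in> verts B"
  unfolding mono_path_def is_path_def using hd_in_set by blast

lemma avail_subset: "avail B s j x \<subseteq> component B ` verts B"
  unfolding avail_def using mono_path_hd by blast

lemma finite_avail [simp]: "finite (avail B s j x)"
  using avail_subset finite_subset by (metis finite_imageI finite_verts)

lemma avail_add_vertex_old:
  assumes wf: "wf_board B" "U \<subseteq> verts B" and C: "C \<in> avail B t j x" "C \<notin> component B ` U"
  shows "C \<in> avail (add_vertex B U s) t j x"
proof -
  obtain p where p: "C = component B (hd p)" "mono_path B t p" "length p = j" "card C \<le> x"
    using C(1) unfolding avail_def by blast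
  then have hd: "hd p \<in> verts B" using mono_path_hd by blast
  have "hd p \<notin> (\<Union>u\<in>U. component B u)" using p(1) C(2) component_eq by blast
  then have "component (add_vertex B U s) (hd p) = C"
    using component_add_vertex_old[OF wf hd] p(1) by simp
  moreover have "nverts B \<notin> set p"
    using p(2) nverts_notin unfolding mono_path_def is_path_def by blast
  then have "mono_path (add_vertex B U s) t p"
    using p(2) is_path_add_vertex_old[OF wf] by (auto simp: mono_path_def)
  ultimately show ?thesis using p(3,4) unfolding avail_def by blast
qed

lemma new_component_avail:
  assumes wf: "wf_board B" "U \<subseteq> verts B"
    and p: "p = [] \<or> mono_path B s p \<and> hd p \<in> U" and q: "q = [] \<or> mono_path B s q \<and> hd q \<in> U"
    and ne: "p \<noteq> [] \<Longrightarrow> q \<noteq> [] \<Longrightarrow> component B (hd p) \<noteq> component B (hd q)"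
    and card: "card (component (add_vertex B U s) (nverts B)) \<le> x"
  shows "component (add_vertex B U s) (nverts B) \<in>
    avail (add_vertex B U s) s (Suc (length p + length q)) x"
proof -
  let ?B = "add_vertex B U s" and ?v = "nverts B"
  define r where "r = rev p @ ?v # q"
  have "set p \<inter> set q = {}"
  proof (cases "p = [] \<or> q = []")
    case False
    then have "set p \<subseteq> component B (hd p)" "set q \<subseteq> component B (hd q)"
      using p q path_in_component unfolding mono_path_def is_path_def by blast+
    then show ?thesis using ne False component_disjoint by blast
  qed auto
  moreover have "p \<noteq> [] \<Longrightarrow> is_path B (rev p) \<and> last (rev p) \<in> U"
    using p successively_rev_edges[of "edges B" p] by (auto simp: mono_path_def is_path_def last_rev)
  ultimately have path: "is_path ?B r"
    unfolding r_def using q by (subst is_path_add_vertex_iff[OF wf]) (auto simp: mono_path_def)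
  have "\<forall>x\<in>set p \<union> set q. colour B x = s" using p q by (auto simp: mono_path_def)
  then have "mono_path ?B s r" using path by (auto simp: mono_path_def r_def)
  moreover have "?v \<in> component ?B (hd r)"
    using path unfolding is_path_def by (intro path_in_component) (auto simp: r_def)
  then have "component ?B ?v = component ?B (hd r)" by (rule component_eq)
  moreover have "length r = Suc (length p + length q)" by (simp add: r_def)
  ultimately show ?thesis using card unfolding avail_def by force
qed

lemma admissible_add_vertex:
  assumes wf: "wf_board B" "U \<subseteq> verts B" and adm: "admissible k B"
    and ne: "\<And>u w. u \<in> U \<Longrightarrow> w \<in> U \<Longrightarrow> u \<noteq> w \<Longrightarrow> component B u \<noteq> component B w"
    and card: "card (insert (nverts B) (\<Union>u\<in>U. component B u)) \<le> k"
  shows "admissible k (add_vertex B U s)"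
proof -
  let ?B = "add_vertex B U s" and ?v = "nverts B"
  have "is_forest ?B" using adm ne wf by (intro is_forest_add_vertex) (auto simp: admissible_def)
  moreover have "card (component ?B w) \<le> k" if "w \<in> verts ?B" for w
  proof (cases "w \<in> component ?B ?v")
    case True
    then have "component ?B w = component ?B ?v" by (rule component_eq)
    then show ?thesis using card component_add_vertex_new[OF wf] by simp
  next
    case False
    then have "w \<in> verts B" "w \<notin> (\<Union>u\<in>U. component B u)"
      using that component_add_vertex_new[OF wf] by auto
    then show ?thesis using component_add_vertex_old[OF wf] adm by (auto simp: admissible_def)
  qed
  ultimately show ?thesis by (simp add: admissible_def)
qed

text \<open>\<open>F\<close> holds components already chosen in the current move, \<open>D\<close>
  those set aside for later. Length 0 yields the empty arm and needs no stock.\<close>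

lemma pick_arm:
  assumes "0 < j \<Longrightarrow> card F < card (avail B s j (x_val \<alpha> s j) - D)" "finite F"
  obtains p where "length p = j" "p \<noteq> [] \<Longrightarrow> mono_path B s p"
    "p \<noteq> [] \<Longrightarrow> component B (hd p) \<notin> F" "p \<noteq> [] \<Longrightarrow> component B (hd p) \<notin> D"
    "p \<noteq> [] \<Longrightarrow> card (component B (hd p)) \<le> x_val \<alpha> s (length p)"
proof (cases "j = 0")
  case False
  then have "\<not> avail B s j (x_val \<alpha> s j) - D \<subseteq> F"
    using assms card_mono[of F] by (metis neq0_conv not_le)
  then obtain C where "C \<in> avail B s j (x_val \<alpha> s j)" "C \<notin> D" "C \<notin> F" by blast
  then show ?thesis using that unfolding avail_def by blast
qed (use that[of "[]"] in simp)

text \<open>The new vertex joins an optimal pair of arms in each colour, so either answer extends a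
  longest path by one vertex at total size at most \<open>k_last \<alpha>\<close>. A stock of four
  suffices, since at most three components are taken before the last arm is chosen.\<close>

lemma builder_move:
  assumes wf: "wf_board B" and adm: "admissible k B" and k: "k_last \<alpha> \<le> k"
    and stock: "\<And>s j. s \<in> {1, 2} \<Longrightarrow> 1 \<le> j \<Longrightarrow> j \<le> count_list \<alpha> s \<Longrightarrow>
        4 \<le> card (avail B s j (x_val \<alpha> s j) - D)"
  obtains U where "U \<subseteq> verts B" "card U \<le> 4" "\<And>u. u \<in> U \<Longrightarrow> component B u \<notin> D"
    "\<And>s. admissible k (add_vertex B U s)"
    "\<And>s. s \<in> {1, 2} \<Longrightarrow> component (add_vertex B U s) (nverts B) \<in>
        avail (add_vertex B U s) s (Suc (count_list \<alpha> s)) (k_last \<alpha>)"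
proof -
  obtain j1 j2 where j: "j1 + j2 = count_list \<alpha> 1"
      "min_split (x_val \<alpha> 1) (count_list \<alpha> 1) = x_val \<alpha> 1 j1 + x_val \<alpha> 1 j2"
    by (rule min_split_attained)
  obtain i1 i2 where i: "i1 + i2 = count_list \<alpha> 2"
      "min_split (x_val \<alpha> 2) (count_list \<alpha> 2) = x_val \<alpha> 2 i1 + x_val \<alpha> 2 i2"
    by (rule min_split_attained)
  define f where "f p = component B (hd p)" for p
  have lt: "card F < card (avail B s j (x_val \<alpha> s j) - D)"
    if "card F \<le> 3" "s \<in> {1, 2}" "j \<le> count_list \<alpha> s" "0 < j" for F :: "nat set set" and s j
    using stock[of s j] that by (simp add: One_nat_def)
  have card3: "card {a, b, c} \<le> 3" "card {a, b} \<le> 3" "card {a} \<le> 3" for a b c :: "nat set"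
    by (auto intro: order_trans[OF card_insert_le_m1] simp: card_insert_if)
  obtain p1 where p1: "length p1 = j1" "p1 \<noteq> [] \<Longrightarrow> mono_path B 1 p1" "p1 \<noteq> [] \<Longrightarrow> f p1 \<notin> {}"
      "p1 \<noteq> [] \<Longrightarrow> f p1 \<notin> D" "p1 \<noteq> [] \<Longrightarrow> card (f p1) \<le> x_val \<alpha> 1 (length p1)"
    using pick_arm[of j1 "{}" B 1 \<alpha> D, OF lt] j unfolding f_def by (auto simp: One_nat_def)
  obtain p2 where p2: "length p2 = j2" "p2 \<noteq> [] \<Longrightarrow> mono_path B 1 p2" "p2 \<noteq> [] \<Longrightarrow> f p2 \<notin> {f p1}"
      "p2 \<noteq> [] \<Longrightarrow> f p2 \<notin> D" "p2 \<noteq> [] \<Longrightarrow> card (f p2) \<le> x_val \<alpha> 1 (length p2)"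
    using pick_arm[of j2 "{f p1}" B 1 \<alpha> D, OF lt[OF card3(3)]] j unfolding f_def by auto
  obtain q1 where q1: "length q1 = i1" "q1 \<noteq> [] \<Longrightarrow> mono_path B 2 q1" "q1 \<noteq> [] \<Longrightarrow> f q1 \<notin> {f p1, f p2}"
      "q1 \<noteq> [] \<Longrightarrow> f q1 \<notin> D" "q1 \<noteq> [] \<Longrightarrow> card (f q1) \<le> x_val \<alpha> 2 (length q1)"
    using pick_arm[of i1 "{f p1, f p2}" B 2 \<alpha> D, OF lt[OF card3(2)]] i unfolding f_def by auto
  obtain q2 where q2: "length q2 = i2" "q2 \<noteq> [] \<Longrightarrow> mono_path B 2 q2" "q2 \<noteq> [] \<Longrightarrow> f q2 \<notin> {f p1, f p2, f q1}"
      "q2 \<noteq> [] \<Longrightarrow> f q2 \<notin> D" "q2 \<noteq> [] \<Longrightarrow> card (f q2) \<le> x_val \<alpha> 2 (length q2)"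
    using pick_arm[of i2 "{f p1, f p2, f q1}" B 2 \<alpha> D, OF lt[OF card3(1)]] i unfolding f_def by auto
  define R where "R = {p1, p2, q1, q2} - {[]}"
  define U where "U = hd ` R"
  have U: "U \<subseteq> verts B"
    using p1(2) p2(2) q1(2) q2(2) mono_path_hd unfolding U_def R_def by blast
  have cardU: "card U \<le> 4"
  proof -
    have "card U \<le> card R" unfolding U_def R_def by (intro card_image_le) simp
    also have "\<dots> \<le> card {p1, p2, q1, q2}" unfolding R_def by (intro card_mono) auto
    also have "\<dots> \<le> 4" by (simp add: card_insert_if)
    finally show ?thesis .
  qed
  have D: "component B u \<notin> D" if "u \<in> U" for u
    using that p1(4) p2(4) q1(4) q2(4) unfolding U_def R_def f_def by blast
  have neR: "f r \<noteq> f r'" if "r \<in> R" "r' \<in> R" "r \<noteq> r'" for r r'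
    using that p1(3) p2(3) q1(3) q2(3) unfolding R_def by auto
  then have ne: "component B u \<noteq> component B w" if "u \<in> U" "w \<in> U" "u \<noteq> w" for u w
    using that unfolding U_def f_def by blast
  define c where "c r = (if r = [] then {} else f r)" for r
  have "(\<Union>u\<in>U. component B u) = c p1 \<union> c p2 \<union> c q1 \<union> c q2"
    unfolding U_def R_def c_def f_def by auto
  moreover have "card (c p1 \<union> c p2 \<union> c q1 \<union> c q2) \<le> card (c p1) + card (c p2) + card (c q1) + card (c q2)"
    by (meson add_le_mono card_Un_le le_refl order_trans)
  moreover have "card (c p1) + card (c p2) + card (c q1) + card (c q2)
      \<le> x_val \<alpha> 1 j1 + x_val \<alpha> 1 j2 + x_val \<alpha> 2 i1 + x_val \<alpha> 2 i2"
    using p1(1,5) p2(1,5) q1(1,5) q2(1,5) by (intro add_mono) (auto simp: c_def x_val_0)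
  moreover have "card (insert (nverts B) (\<Union>u\<in>U. component B u)) \<le> Suc (card (\<Union>u\<in>U. component B u))"
    by (rule card_insert_le_m1) auto
  ultimately have card: "card (insert (nverts B) (\<Union>u\<in>U. component B u)) \<le> k_last \<alpha>"
    using i j by (simp add: k_last_eq_sum)
  have neq: "p \<noteq> [] \<Longrightarrow> q \<noteq> [] \<Longrightarrow> component B (hd p) \<noteq> component B (hd q)"
    if "(p, q) = (p1, p2) \<or> (p, q) = (q1, q2)" for p q
    using that p2(3) q2(3) unfolding f_def by auto
  have inU: "p = [] \<or> hd p \<in> U" if "p \<in> {p1, p2, q1, q2}" for p
    using that unfolding U_def R_def by blast
  have "component (add_vertex B U s) (nverts B) \<in>
        avail (add_vertex B U s) s (Suc (count_list \<alpha> s)) (k_last \<alpha>)" if s: "s \<in> {1, 2}" for s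
  proof -
    have "card (component (add_vertex B U s) (nverts B)) \<le> k_last \<alpha>"
      using card by (simp only: component_add_vertex_new[OF wf U])
    note new = new_component_avail[OF wf U _ _ _ this]
    show ?thesis
    proof (cases "s = 1")
      case True
      have "p1 = [] \<or> mono_path B s p1 \<and> hd p1 \<in> U" "p2 = [] \<or> mono_path B s p2 \<and> hd p2 \<in> U"
        using p1(2) p2(2) inU[of p1] inU[of p2] True by auto
      from new[OF this neq] show ?thesis using p1(1) p2(1) j(1) True by simp
    next
      case False
      then have "s = 2" using s by simp
      then have "q1 = [] \<or> mono_path B s q1 \<and> hd q1 \<in> U" "q2 = [] \<or> mono_path B s q2 \<and> hd q2 \<in> U"
        using q1(2) q2(2) inU[of q1] inU[of q2]  by auto
      from new[OF this neq] show ?thesis using q1(1) q2(1) i(1) \<open>s = 2\<close> by simp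
    qed
  qed
  moreover have "admissible k (add_vertex B U s)" for s
    using admissible_add_vertex[OF wf U adm ne] card k by simp
  ultimately show ?thesis using that U cardU D by blast
qed

text \<open>The stock Builder needs when Painter's choices so far spell \<open>\<alpha>\<close>. One
  component may count for several lengths.\<close>

definition rich :: "nat list \<Rightarrow> nat \<Rightarrow> board \<Rightarrow> bool" where
  "rich \<alpha> n B \<longleftrightarrow> wf_board B \<and>
     (\<forall>s\<in>{1, 2}. \<forall>j. 1 \<le> j \<longrightarrow> j \<le> count_list \<alpha> s \<longrightarrow> n \<le> card (avail B s j (x_val \<alpha> s j)))"

text \<open>Builder repeats the same move; \<open>D s\<close> collects the components produced so far in
  colour \<open>s\<close>, which are not consumed by later moves.\<close>

lemma builder_phase:
  assumes k: "k_last \<alpha> \<le> k"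
  shows "wf_board B \<Longrightarrow> admissible k B \<Longrightarrow>
    (\<And>s. s \<in> {1, 2} \<Longrightarrow> D s \<subseteq> avail B s (Suc (count_list \<alpha> s)) (k_last \<alpha>)) \<Longrightarrow>
    (\<And>s j. s \<in> {1, 2} \<Longrightarrow> 1 \<le> j \<Longrightarrow> j \<le> count_list \<alpha> s \<Longrightarrow>
        n + 4 * m \<le> card (avail B s j (x_val \<alpha> s j) - (D 1 \<union> D 2))) \<Longrightarrow>
    2 * n \<le> card (D 1) + card (D 2) + m \<Longrightarrow>
    reach k (\<lambda>B. admissible k B \<and> (\<exists>s\<in>{1, 2}. rich (\<alpha> @ [s]) n B)) B"
proof (induction m arbitrary: B D)
  case 0
  \<comment> \<open>No move is left, so at least \<open>2 * n\<close> components have been produced,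
    and one colour has \<open>n\<close> of them.\<close>
  obtain s where s: "s \<in> {1, 2}" "n \<le> card (D s)"
    using 0(5) by (metis add_0_right add_le_cancel_left insertCI linorder_not_le add_less_mono mult_2)
  have "n \<le> card (avail B t j (x_val (\<alpha> @ [s]) t j))"
    if t: "t \<in> {1, 2}" "1 \<le> j" "j \<le> count_list (\<alpha> @ [s]) t" for t j
  proof (cases "j \<le> count_list \<alpha> t")
    case True
    have "n \<le> card (avail B t j (x_val \<alpha> t j) - (D 1 \<union> D 2))" using 0(4)[of t j] t True by simp
    also have "\<dots> \<le> card (avail B t j (x_val \<alpha> t j))" by (intro card_mono) auto
    finally show ?thesis using True by (simp only: x_val_append)
  next
    case False
    then have "t = s" "j = Suc (count_list \<alpha> s)" using t by (auto split: if_splits)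
    moreover have "card (D s) \<le> card (avail B s (Suc (count_list \<alpha> s)) (k_last \<alpha>))"
      using 0(3) s by (intro card_mono) auto
    ultimately show ?thesis using s by (simp add: x_val_snoc)
  qed
  then have "rich (\<alpha> @ [s]) n B" using 0(1) by (simp add: rich_def)
  then show ?case using 0(2) s by (intro reach.here) blast
next
  case (Suc m)
  have ge4: "4 \<le> card (avail B s j (x_val \<alpha> s j) - (D 1 \<union> D 2))"
    if "s \<in> {1, 2}" "1 \<le> j" "j \<le> count_list \<alpha> s" for s j
    using Suc.prems(4)[OF that] by simp
  obtain U where U: "U \<subseteq> verts B" "card U \<le> 4" "\<And>u. u \<in> U \<Longrightarrow> component B u \<notin> D 1 \<union> D 2"
    and adm: "\<And>s. admissible k (add_vertex B U s)"
    and new: "\<And>s. s \<in> {1, 2} \<Longrightarrow> component (add_vertex B U s) (nverts B) \<in>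
        avail (add_vertex B U s) s (Suc (count_list \<alpha> s)) (k_last \<alpha>)"
    by (rule builder_move[OF Suc.prems(1,2) k, of "D 1 \<union> D 2"]) (use ge4 in \<open>auto simp: One_nat_def\<close>)
  note wf = Suc.prems(1) U(1)
  show ?case
  proof (rule reach.move[OF U(1)], intro conjI adm)
    fix s :: nat assume s: "s \<in> {1, 2}"
    let ?B = "add_vertex B U s"
    define N where "N = component ?B (nverts B)"
    define D' where "D' = D(s := insert N (D s))"
    \<comment> \<open>The product contains the new vertex, so it is no component of the old board;
      in particular it is not yet counted in \<open>D\<close>.\<close>
    have notin: "N \<notin> avail B t j x" for t j x
    proof
      assume "N \<in> avail B t j x"
      then obtain w where "w \<in> verts B" "N = component B w" using avail_subset by blast
      then have "N \<subseteq> verts B" using component_subset_verts[OF wf(1)] by simp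
      then show False using nverts_notin[of B] unfolding N_def by (meson component_refl subsetD)
    qed
    have finD: "finite (D t)" if "t \<in> {1, 2}" for t
      using Suc.prems(3)[OF that] finite_avail finite_subset by blast
    have D12: "D' 1 \<union> D' 2 = insert N (D 1 \<union> D 2)" using s by (auto simp: D'_def)
    show "reach k (\<lambda>B. admissible k B \<and> (\<exists>s\<in>{1, 2}. rich (\<alpha> @ [s]) n B)) ?B"
    proof (rule Suc.IH[of ?B D'])
      show "wf_board ?B" by (rule wf_board_add_vertex[OF wf])
      show "admissible k ?B" by (rule adm)
      show "D' t \<subseteq> avail ?B t (Suc (count_list \<alpha> t)) (k_last \<alpha>)" if t: "t \<in> {1, 2}" for t
      proof
        fix C assume C: "C \<in> D' t"
        show "C \<in> avail ?B t (Suc (count_list \<alpha> t)) (k_last \<alpha>)"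
        proof (cases "C \<in> D t")
          case True
          have "C \<notin> component B ` U" using True U(3) t by auto
          then show ?thesis using avail_add_vertex_old[OF wf] Suc.prems(3)[OF t] True by blast
        next
          case False
          then have "t = s" "C = N" using C by (auto simp: D'_def split: if_splits)
          then show ?thesis using new[OF s] by (simp add: N_def)
        qed
      qed
      show "n + 4 * m \<le> card (avail ?B t j (x_val \<alpha> t j) - (D' 1 \<union> D' 2))"
        if t: "t \<in> {1, 2}" "1 \<le> j" "j \<le> count_list \<alpha> t" for t j
      proof -
        let ?A = "avail B t j (x_val \<alpha> t j) - (D 1 \<union> D 2)"
        have finU: "finite U" using U(1) finite_verts finite_subset by blast
        then have "card (component B ` U) \<le> 4" using U(2) card_image_le order_trans by blast
        \<comment> \<open>A move uses up at most four components, which accounts for the drop from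
          \<open>4 * Suc m\<close> to \<open>4 * m\<close>.\<close>
        then have "n + 4 * m \<le> card ?A - card (component B ` U)"
          using Suc.prems(4)[OF t] by simp
        also have "\<dots> \<le> card (?A - component B ` U)"
          using finU by (intro diff_card_le_card_Diff) auto
        also have "\<dots> \<le> card (avail ?B t j (x_val \<alpha> t j) - (D' 1 \<union> D' 2))"
        proof (intro card_mono)
          show "?A - component B ` U \<subseteq> avail ?B t j (x_val \<alpha> t j) - (D' 1 \<union> D' 2)"
            unfolding D12 using avail_add_vertex_old[OF wf] notin by blast
        qed auto
        finally show ?thesis .
      qed
      have "N \<notin> D s" using Suc.prems(3)[OF s] notin by blast
      then have "card (D' 1) + card (D' 2) = Suc (card (D 1) + card (D 2))"
        using s finD by (auto simp: D'_def)
      then show "2 * n \<le> card (D' 1) + card (D' 2) + m" using Suc.prems(5) by simp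
    qed
  qed
qed

section \<open>Concatenation of Builder's phases\<close>

lemma rich_mono: "n \<le> m \<Longrightarrow> rich \<alpha> m B \<Longrightarrow> rich \<alpha> n B"
  unfolding rich_def by (meson order_trans)

lemma rich_imp_lost:
  assumes "rich \<alpha> n B" "1 \<le> n" "count_list \<alpha> s = m" "1 \<le> m" "(s, m) \<in> {(1, l), (2, c)}"
  shows "painter_lost l c B"
proof -
  have "s \<in> {1, 2}" using assms(5) by auto
  then have "1 \<le> card (avail B s m (x_val \<alpha> s m))"
    using assms(1-4) unfolding rich_def by (meson order_refl order_trans)
  then obtain C where "C \<in> avail B s m (x_val \<alpha> s m)" by (metis card.empty ex_in_conv not_one_le_zero)
  then have "has_mono_path B s m" unfolding avail_def has_mono_path_def mono_path_def by blast
  then show ?thesis using assms(5) by (auto simp: painter_lost_def)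
qed

text \<open>Backward induction on the sequence Painter has spelled out. The demand \<open>N\<close>
  depends on \<open>\<alpha>\<close>: it must cover the next phase and leave enough for both
  possible continuations.\<close>

lemma rich_reach_lost:
  assumes K: "\<And>\<alpha>. \<alpha> \<in> W l c \<Longrightarrow> k_last \<alpha> \<le> k"
  shows "set \<alpha> \<subseteq> {1, 2} \<Longrightarrow> count_list \<alpha> 1 < l \<Longrightarrow> count_list \<alpha> 2 < c \<Longrightarrow>
    \<exists>N. \<forall>B. admissible k B \<longrightarrow> rich \<alpha> N B \<longrightarrow> reach k (painter_lost l c) B"
proof (induction "l + c - length \<alpha>" arbitrary: \<alpha> rule: less_induct)
  case less
  have len: "length \<alpha> = count_list \<alpha> 1 + count_list \<alpha> 2"
    using less.prems(1) by (induction \<alpha>) auto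
  have k: "k_last \<alpha> \<le> k"
    using K[OF extend_to_W[OF less.prems]] k_last_append le_trans by blast
  have ex: "\<exists>N. \<forall>B. admissible k B \<longrightarrow> rich (\<alpha> @ [s]) N B \<longrightarrow> reach k (painter_lost l c) B"
    if s: "s \<in> {1, 2}" for s
  proof (cases "count_list (\<alpha> @ [s]) 1 < l \<and> count_list (\<alpha> @ [s]) 2 < c")
    case True
    then show ?thesis using less.prems s len by (intro less.hyps) auto
  next
    case False
    then have "(s, count_list (\<alpha> @ [s]) s) \<in> {(1, l), (2, c)}"
      using less.prems s by (auto split: if_splits)
    then have "rich (\<alpha> @ [s]) 1 B \<Longrightarrow> painter_lost l c B" for B
      by (intro rich_imp_lost[of "\<alpha> @ [s]" 1 B s]) auto
    then show ?thesis using reach.here by blast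
  qed
  obtain N1 N2 where
    N1: "\<And>B. admissible k B \<Longrightarrow> rich (\<alpha> @ [1]) N1 B \<Longrightarrow> reach k (painter_lost l c) B" and
    N2: "\<And>B. admissible k B \<Longrightarrow> rich (\<alpha> @ [2]) N2 B \<Longrightarrow> reach k (painter_lost l c) B"
    using ex[of 1] ex[of 2] by auto
  define n where "n = max N1 N2"
  \<comment> \<open>A phase takes \<open>2 * n\<close> moves at four components each and must leave
    \<open>n\<close> for the next one.\<close>
  have "reach k (painter_lost l c) B" if "admissible k B" "rich \<alpha> (n + 4 * (2 * n)) B" for B
  proof (rule reach_trans)
    show "reach k (\<lambda>B. admissible k B \<and> (\<exists>s\<in>{1, 2}. rich (\<alpha> @ [s]) n B)) B"
      using that by (intro builder_phase[OF k, where D = "\<lambda>_. {}" and m = "2 * n"]) (auto simp: rich_def)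
  next
    fix B assume "admissible k B \<and> (\<exists>s\<in>{1, 2}. rich (\<alpha> @ [s]) n B)"
    then show "reach k (painter_lost l c) B"
      using N1 N2 rich_mono[of N1 n] rich_mono[of N2 n] by (auto simp: n_def)
  qed
  then show ?case by blast
qed

lemma builder_wins_of_k_last_le:
  assumes "\<And>\<alpha>. \<alpha> \<in> W l c \<Longrightarrow> k_last \<alpha> \<le> k" "1 \<le> l" "1 \<le> c"
  shows "builder_wins k l c"
proof -
  have "admissible k empty_board"
    by (auto simp: admissible_def is_forest_def is_cycle_def is_path_def verts_def empty_board_def)
  \<comment> \<open>For the empty sequence no stock is demanded, so the empty board satisfies every
    \<open>N\<close>.\<close>
  moreover have "rich [] N empty_board" for N by (simp add: rich_def)
  moreover have "\<exists>N. \<forall>B. admissible k B \<longrightarrow> rich [] N B \<longrightarrow> reach k (painter_lost l c) B"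
    using assms by (intro rich_reach_lost) auto
  ultimately have "reach k (painter_lost l c) empty_board" by blast
  then show ?thesis unfolding builder_wins_def by (rule reach_lost_imp_forces)
qed

lemma W_nonempty: "1 \<le> l \<Longrightarrow> 1 \<le> c \<Longrightarrow> W l c \<noteq> {}"
  using extend_to_W[of "[]" l c] by auto

lemma k_last_pos: "1 \<le> k_last \<alpha>"
  by (simp add: k_last_eq_sum)

text \<open>\<open>\<alpha>\<close> maximises the last size over the finite set
  \<open>W l c\<close>, and Builder's strategy works with that size as the limit.\<close>

lemma k_star_attained:
  assumes "1 \<le> l" "1 \<le> c"
  obtains \<alpha> where "\<alpha> \<in> W l c" "builder_wins (k_last \<alpha>) l c" "k_star l c \<le> k_last \<alpha>"
proof -
  have "Max (k_last ` W l c) \<in> k_last ` W l c"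
    using assms finite_W W_nonempty by (intro Max_in) auto
  then obtain \<alpha> where a: "\<alpha> \<in> W l c" "k_last \<alpha> = Max (k_last ` W l c)" by force
  then have "builder_wins (k_last \<alpha>) l c"
    using assms finite_W by (intro builder_wins_of_k_last_le) auto
  then show ?thesis using that[OF a(1)] k_last_pos unfolding k_star_def by (auto intro: Least_le)
qed

lemma k_last_le_k_star:
  assumes "1 \<le> l" "1 \<le> c" "\<alpha> \<in> W l c"
  shows "k_last \<alpha> \<le> k_star l c"
proof -
  obtain \<gamma> where "builder_wins (k_last \<gamma>) l c" using k_star_attained[OF assms(1,2)] by blast
  then have "k_star l c \<ge> 1 \<and> builder_wins (k_star l c) l c"

    unfolding k_star_def
    by (intro LeastI[of "\<lambda>k. k \<ge> 1 \<and> builder_wins k l c" "k_last \<gamma>"]) (simp add: k_last_pos)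
  then show ?thesis using builder_wins_imp_k_last_le assms by blast
qed

section \<open>The asymptotics\<close>

text \<open>Choose a sequence whose value \<open>D\<close> exceeds \<open>d\<close>, and append
  ones: its linear lower bound persists up to a constant that does not depend on
  \<open>l\<close>.\<close>

lemma k_star_lower:
  assumes "1 \<le> c" "d < \<delta> c"
  obtains l0 D b where "d < D" "0 \<le> b"
    "\<And>l. 1 \<le> l \<Longrightarrow> l0 \<le> l \<Longrightarrow> D * real l - b \<le> real (k_star l c)"
proof -
  have "\<exists>D l0 \<alpha>. d < D \<and> 1 \<le> l0 \<and> \<alpha> \<in> W l0 c \<and>
    (\<forall>j < l0. D * real (j + 1) \<le> real (x_val \<alpha> 1 j + two_cost \<alpha>))"
  proof (cases "c = 1")
    case True
    then show ?thesis using assms(2)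
      by (intro exI[of _ 1] exI[of _ "[]"]) (auto simp: \<delta>_def W_def two_cost_def)
  next
    case False
    then have "2 \<le> c" using assms by simp
    \<comment> \<open>The sequence of twos alone shows that the supremum is over a nonempty
      set.\<close>
    have "replicate (c - 1) 2 \<in> W 1 c" "last (replicate (c - 1) (2::nat)) = 2"
      using \<open>2 \<le> c\<close> by (auto simp: W_iff count_list_replicate)
    then have "\<delta>_values c \<noteq> {}" unfolding \<delta>_values_def by blast
    then obtain D where D: "D \<in> \<delta>_values c" "d < D"
      using assms False less_cSup_iff[OF _ bdd_above_\<delta>_values[OF \<open>2 \<le> c\<close>]] by (auto simp: \<delta>_def)
    then obtain l0 \<alpha> where a: "1 \<le> l0" "\<alpha> \<in> W l0 c" "D = \<delta>_seq l0 c \<alpha>"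
      unfolding \<delta>_values_def by blast
    then have "D * real (j + 1) \<le> real (x_val \<alpha> 1 j + two_cost \<alpha>)" if "j < l0" for j
      using \<delta>_seq_le[OF that, of c \<alpha>] \<beta>_eq_two_cost[OF a(2)] by (simp add: field_simps)
    then show ?thesis using a D(2) by blast
  qed
  then obtain D l0 \<alpha> where D: "d < D" "1 \<le> l0" "\<alpha> \<in> W l0 c"
    "\<And>j. j < l0 \<Longrightarrow> D * real (j + 1) \<le> real (x_val \<alpha> 1 j + two_cost \<alpha>)" by blast
  then have n: "count_list \<alpha> 1 = l0 - 1" "count_list \<alpha> 2 = c - 1" "set \<alpha> \<subseteq> {1, 2}" by (auto simp: W_def)
  \<comment> \<open>The bound obtained is for \<open>D * real (l + 1)\<close>. As the sign of
    \<open>D\<close> is not known, \<open>\<bar>D\<bar>\<close> absorbs the extra \<open>D\<close>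
    and keeps the constant non-negative.\<close>
  have "D * real l - (real (two_cost \<alpha>) + \<bar>D\<bar>) \<le> real (k_star l c)" if l: "1 \<le> l" "l0 \<le> l" for l
  proof -
    let ?a = "\<alpha> @ replicate (l - l0) 1"
    have "?a \<in> W l c"
      using n D(2) l assms by (subst W_iff) (auto simp: count_list_replicate)
    then have "k_last ?a \<le> k_star l c" using k_last_le_k_star l assms by blast
    then have "real (k_last ?a) \<le> real (k_star l c)" by simp
    moreover have "D * real (count_list \<alpha> 1 + (l - l0) + 2) \<le> real (k_last ?a + two_cost \<alpha>)"
      using D n by (intro k_last_append_ones_ge) auto
    moreover have "count_list \<alpha> 1 + (l - l0) + 2 = l + 1" using n D(2) l by simp
    ultimately have "D * real (l + 1) \<le> real (k_last ?a + two_cost \<alpha>)" "real (k_last ?a) \<le> real (k_star l c)"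
      by (simp_all only:)
    moreover have "D * real (l + 1) = D * real l + D" by (simp add: algebra_simps)
    ultimately show ?thesis by linarith
  qed
  then show ?thesis using that[OF D(1), of "real (two_cost \<alpha>) + \<bar>D\<bar>" l0] by simp
qed

text \<open>Boundedness and the existence of a winning \<open>k\<close> ensure that
  \<open>Sup\<close> and \<open>LEAST\<close> in \<open>\<delta>\<close> and \<open>k_star\<close>
  denote the intended numbers.\<close>

theorem theorem16:
  shows "(\<forall>c\<ge>2. bdd_above (\<delta>_values c)) \<and>
    (\<forall>c\<ge>1. \<forall>l\<ge>1. (\<exists>k\<ge>1. builder_wins k l c) \<and> real (k_star l c) \<le> \<delta> c * real l) \<and>
    (\<exists>\<epsilon> :: nat \<Rightarrow> nat \<Rightarrow> real.
       (\<forall>c\<ge>1. \<forall>l\<ge>1. \<epsilon> c l \<ge> 0) \<and>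
       (\<forall>c\<ge>1. (\<lambda>l. \<epsilon> c l) \<longlonglongrightarrow> 0) \<and>
       (\<forall>c\<ge>1. \<forall>l\<ge>1. real (k_star l c) \<ge> (\<delta> c - \<epsilon> c l) * real l))"
proof (intro conjI allI impI)
  fix c l :: nat assume c: "1 \<le> c" and l: "1 \<le> l"
  obtain \<alpha> where a: "\<alpha> \<in> W l c" "builder_wins (k_last \<alpha>) l c" "k_star l c \<le> k_last \<alpha>"
    using k_star_attained[OF l c] .
  then show "\<exists>k\<ge>1. builder_wins k l c" using k_last_pos by blast
  show "real (k_star l c) \<le> \<delta> c * real l"
    using k_last_le_\<delta>[OF c l a(1)] a(3) by (meson of_nat_mono order_trans)
next
  \<comment> \<open>The smallest non-negative error for which the lower bound holds when
    \<open>l \<ge> 1\<close>.\<close>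
  let ?e = "\<lambda>c l. max 0 (\<delta> c - real (k_star l c) / real l)"
  show "\<exists>\<epsilon> :: nat \<Rightarrow> nat \<Rightarrow> real.
       (\<forall>c\<ge>1. \<forall>l\<ge>1. \<epsilon> c l \<ge> 0) \<and>
       (\<forall>c\<ge>1. (\<lambda>l. \<epsilon> c l) \<longlonglongrightarrow> 0) \<and>
       (\<forall>c\<ge>1. \<forall>l\<ge>1. real (k_star l c) \<ge> (\<delta> c - \<epsilon> c l) * real l)"
  proof (intro exI[of _ ?e] conjI allI impI)
    fix c :: nat assume c: "1 \<le> c"
    show "?e c \<longlonglongrightarrow> 0"
    proof (rule LIMSEQ_I)
      fix e :: real assume "0 < e"
      \<comment> \<open>Half of \<open>e\<close> is spent on approximating \<open>\<delta> c\<close>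
        by \<open>D\<close>, the other half on \<open>b / real l\<close>.\<close>
      then have "\<delta> c - e / 2 < \<delta> c" by simp
      then obtain l0 D b where D: "\<delta> c - e / 2 < D" "0 \<le> b"
        "\<And>l. 1 \<le> l \<Longrightarrow> l0 \<le> l \<Longrightarrow> D * real l - b \<le> real (k_star l c)"
        by (rule k_star_lower[OF c]) blast
      obtain n0 :: nat where n0: "2 * b / e < real n0" using reals_Archimedean2 by blast
      have "norm (?e c l - 0) < e" if "max l0 (max n0 1) \<le> l" for l
      proof -
        have l: "l0 \<le> l" "1 \<le> l" "real n0 \<le> real l" using that by auto
        then have "b / real l < e / 2"
        proof -
          have "2 * b / e < real l" using n0 l(3) by linarith
          then show ?thesis using \<open>0 < e\<close> l(2) by (simp add: field_simps)
        qed
        moreover have "(D * real l - b) / real l \<le> real (k_star l c) / real l"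
          using D(3)[OF l(2,1)] by (intro divide_right_mono) auto
        then have "D - b / real l \<le> real (k_star l c) / real l"
          using l(2) by (simp add: diff_divide_distrib)
        ultimately show ?thesis using D(1) \<open>0 < e\<close> by simp
      qed
      then show "\<exists>no. \<forall>n\<ge>no. norm (?e c n - 0) < e" by blast
    qed
  next
    fix c l :: nat assume "1 \<le> l"
    have "(\<delta> c - ?e c l) * real l \<le> real (k_star l c) / real l * real l"
      by (intro mult_right_mono) auto
    then show "(\<delta> c - ?e c l) * real l \<le> real (k_star l c)" using \<open>1 \<le> l\<close> by simp
  qed simp
qed (rule bdd_above_\<delta>_values)

end
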